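(* Let $\Omega\subseteq \mathbb{R}^d$, let $p:\Omega\to[1,+\infty)$ be a bounded exponent function, and let $\sigma:\mathbb{R}\to\mathbb{R}$ be discriminatory for $L^{p(\cdot)}(K)$ for every compact $K\subset\Omega$. Then the truncated finite sums of the form $$ g(x)=\begin{cases}\displaystyle\sum_{j=1}^M \alpha_j\,\sigma(w_j\cdot x+b_j) & x\in K,\\ 0 & x\in\Omega\setminus K,\end{cases} $$ with $K\subset\Omega$ compact, $M\in\mathbb{N}$, $\alpha_j,b_j\in\mathbb{R}$ and $w_j\in\mathbb{R}^d$, are dense in $L^{p(\cdot)}(\Omega)$.
   Context: $\Omega\subseteq\mathbb{R}^d$ is equipped with the Lebesgue measurable sets and Lebesgue measure $|\cdot|$. An exponent function is a measurable function $p:\Omega\to[1,+\infty)$; it is bounded if $\operatorname{ess\,sup}_{x\in\Omega}p(x)<+\infty$. For measurable $f:\Omega\to\mathbb{R}$, $$\|f\|_{p(\cdot)}=\|f\|_{L^{p(\cdot)}(\Omega)}:=\inf\Big\{\lambda>0:\int_\Omega\Big(\frac{|f(x)|}{\lambda}\Big)^{p(x)}\,dx\le 1\Big\},$$ and the variable Lebesgue space $L^{p(\cdot)}(\Omega)$ is the Banach space of measurable $f:\Omega\to\mathbb{R}$ with $\|f\|_{p(\cdot)}<+\infty$. For $K\subset\Omega$ compact, $L^{p(\cdot)}(K)$ is the corresponding space on $K$ with exponent $p$ restricted to $K$. The Hölder conjugate $q$ of $p$ is defined pointwise by $\frac1{p(x)}+\frac1{q(x)}=1$, with $q(x)=+\infty$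 where $p(x)=1$; then $L^{q(\cdot)}(K)$ is defined in the generalized sense, by the same type of norm in which $\int_K(|f|/\lambda)^{q(x)}dx$ is replaced by $\int_{K\cap\{q<\infty\}}(|f|/\lambda)^{q(x)}dx+\operatorname{ess\,sup}_{K\cap\{q=\infty\}}|f|/\lambda$. For a bounded exponent function $p$ and compact $K$, a function $\sigma:\mathbb{R}\to\mathbb{R}$ is discriminatory for $L^{p(\cdot)}(K)$ if for any $h\in L^{q(\cdot)}(K)$, with $q$ the pointwise Hölder conjugate of $p$: whenever $\int_K\sigma(w\cdot x+b)\,h(x)\,dx=0$ for all $w\in\mathbb{R}^d$ and $b\in\mathbb{R}$, then $h=0$ almost everywhere. *)

theory Defs
  imports "HOL-Analysis.Analysis" "HOL-Probability.Essential_Supremum"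
begin

text \<open>
  Functions on a measurable set \<open>\<Omega>\<close> are represented by total functions whose values outside
  \<open>\<Omega>\<close> are irrelevant; measurability on \<open>\<Omega>\<close> is measurability with respect to
  \<^term>\<open>lebesgue_on \<Omega>\<close>.
\<close>

definition exponent_function :: "'a::euclidean_space set \<Rightarrow> ('a \<Rightarrow> real) \<Rightarrow> bool" where
  "exponent_function \<Omega> p \<longleftrightarrow>
     p \<in> borel_measurable (lebesgue_on \<Omega>) \<and> (\<forall>x\<in>\<Omega>. 1 \<le> p x)"

definition bounded_exponent :: "'a::euclidean_space set \<Rightarrow> ('a \<Rightarrow> real) \<Rightarrow> bool" where
  "bounded_exponent \<Omega> p \<longleftrightarrow>
     exponent_function \<Omega> p \<and> esssup (lebesgue_on \<Omega>) (\<lambda>x. ereal (p x)) < \<infinity>"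

definition modular :: "'a::euclidean_space set \<Rightarrow> ('a \<Rightarrow> real) \<Rightarrow> ('a \<Rightarrow> real) \<Rightarrow> ennreal" where
  "modular \<Omega> p f = (\<integral>\<^sup>+ x. ennreal (\<bar>f x\<bar> powr p x) \<partial>lebesgue_on \<Omega>)"

text \<open>The modular for exponents that may take the value \<open>\<infinity>\<close>.\<close>

definition gen_modular :: "'a::euclidean_space set \<Rightarrow> ('a \<Rightarrow> ennreal) \<Rightarrow> ('a \<Rightarrow> real) \<Rightarrow> ennreal" where
  "gen_modular \<Omega> q f =
     modular (\<Omega> \<inter> {x. q x < \<infinity>}) (\<lambda>x. enn2real (q x)) f +
     esssup (lebesgue_on (\<Omega> \<inter> {x. q x = \<infinity>})) (\<lambda>x. ennreal \<bar>f x\<bar>)"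

text \<open>The infimum is taken in \<^typ>\<open>ennreal\<close>, so it is \<open>\<infinity>\<close> if no \<open>\<lambda>\<close> is admissible.\<close>

definition luxemburg_norm :: "(('a \<Rightarrow> real) \<Rightarrow> ennreal) \<Rightarrow> ('a \<Rightarrow> real) \<Rightarrow> ennreal" where
  "luxemburg_norm \<rho> f = Inf {ennreal l | l. 0 < l \<and> \<rho> (\<lambda>x. f x / l) \<le> 1}"

definition Lp_norm :: "'a::euclidean_space set \<Rightarrow> ('a \<Rightarrow> real) \<Rightarrow> ('a \<Rightarrow> real) \<Rightarrow> ennreal" where
  "Lp_norm \<Omega> p = luxemburg_norm (modular \<Omega> p)"

definition Lp_space :: "'a::euclidean_space set \<Rightarrow> ('a \<Rightarrow> real) \<Rightarrow> ('a \<Rightarrow> real) set" where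
  "Lp_space \<Omega> p = {f \<in> borel_measurable (lebesgue_on \<Omega>). Lp_norm \<Omega> p f < \<infinity>}"

definition gen_Lp_norm :: "'a::euclidean_space set \<Rightarrow> ('a \<Rightarrow> ennreal) \<Rightarrow> ('a \<Rightarrow> real) \<Rightarrow> ennreal" where
  "gen_Lp_norm \<Omega> q = luxemburg_norm (gen_modular \<Omega> q)"

definition gen_Lp_space :: "'a::euclidean_space set \<Rightarrow> ('a \<Rightarrow> ennreal) \<Rightarrow> ('a \<Rightarrow> real) set" where
  "gen_Lp_space \<Omega> q = {f \<in> borel_measurable (lebesgue_on \<Omega>). gen_Lp_norm \<Omega> q f < \<infinity>}"

definition hoelder_conj :: "('a \<Rightarrow> real) \<Rightarrow> 'a \<Rightarrow> ennreal" where
  "hoelder_conj p x = (if p x = 1 then \<infinity> else ennreal (p x / (p x - 1)))"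

lemma hoelder_conj_iff:
  assumes "1 \<le> p x"
  shows "1 / ennreal (p x) + 1 / q = 1 \<longleftrightarrow> q = hoelder_conj p x"
proof (cases q rule: ennreal_cases)
  case (real r)
  show ?thesis
  proof (cases "r = 0")
    case True
    have "0 < p x / (p x - 1)" if "p x \<noteq> 1"
      using assms that by simp
    then have "hoelder_conj p x \<noteq> 0"
      by (auto simp: hoelder_conj_def ennreal_eq_0_iff)
    moreover have "1 / q = top"
      using real True by simp
    ultimately show ?thesis
      using real True by simp
  next
    case False
    with real have r: "r > 0" by simp
    have "1 / ennreal (p x) = ennreal (1 / p x)" "1 / q = ennreal (1 / r)"
      using real r assms by (metis divide_ennreal ennreal_1 less_le_trans zero_less_one zero_le_one)+
    then have "1 / ennreal (p x) + 1 / q = ennreal (1 / p x + 1 / r)"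
      using r assms by (metis ennreal_plus divide_nonneg_nonneg less_imp_le order_trans zero_le_one)
    then have "1 / ennreal (p x) + 1 / q = 1 \<longleftrightarrow> 1 / p x + 1 / r = 1"
      by (metis ennreal_eq_1)
    also have "\<dots> \<longleftrightarrow> p x \<noteq> 1 \<and> r = p x / (p x - 1)"
      using r assms by (cases "p x = 1") (auto simp: nonzero_eq_divide_eq field_simps)
    also have "\<dots> \<longleftrightarrow> q = hoelder_conj p x"
    proof (cases "p x = 1")
      case False
      then have "p x / (p x - 1) \<ge> 0" using assms by simp
      with False show ?thesis
        using real by (simp add: hoelder_conj_def ennreal_inj)
    qed (use real in \<open>simp add: hoelder_conj_def\<close>)
    finally show ?thesis .
  qed
next
  case top
  have "1 / ennreal (p x) = ennreal (1 / p x)"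
    using assms by (metis divide_ennreal ennreal_1 less_le_trans zero_less_one zero_le_one)
  then have "1 / ennreal (p x) + 1 / q = 1 \<longleftrightarrow> 1 / p x = 1"
    using top by (simp add: ennreal_eq_1)
  then show ?thesis
    using top assms by (simp add: hoelder_conj_def)
qed

text \<open>
  That every integral appearing in the condition exists is part of the definition: the
  Bochner integral of a non-integrable function is \<open>0\<close> by convention, which must not be
  mistaken for a vanishing integral.
\<close>

definition discriminatory ::
    "'a::euclidean_space set \<Rightarrow> ('a \<Rightarrow> real) \<Rightarrow> (real \<Rightarrow> real) \<Rightarrow> bool" where
  "discriminatory K p \<sigma> \<longleftrightarrow>
     (\<forall>h \<in> gen_Lp_space K (hoelder_conj p).
        (\<forall>w b. integrable (lebesgue_on K) (\<lambda>x. \<sigma> (w \<bullet> x + b) * h x)) \<and>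
        ((\<forall>w b. (LINT x|lebesgue_on K. \<sigma> (w \<bullet> x + b) * h x) = 0) \<longrightarrow>
           (AE x in lebesgue_on K. h x = 0)))"

definition truncated_sums ::
    "'a::euclidean_space set \<Rightarrow> (real \<Rightarrow> real) \<Rightarrow> ('a \<Rightarrow> real) set" where
  "truncated_sums \<Omega> \<sigma> =
     {g. \<exists>K M \<alpha> w b. compact K \<and> K \<subseteq> \<Omega> \<and>
           g = (\<lambda>x. if x \<in> K then \<Sum>j = 1..(M::nat). \<alpha> j * \<sigma> (w j \<bullet> x + b j) else 0)}"

definition dense_in_Lp ::
    "'a::euclidean_space set \<Rightarrow> ('a \<Rightarrow> real) \<Rightarrow> ('a \<Rightarrow> real) set \<Rightarrow> bool" where
  "dense_in_Lp \<Omega> p G \<longleftrightarrow>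
     G \<subseteq> Lp_space \<Omega> p \<and>
     (\<forall>f \<in> Lp_space \<Omega> p. \<forall>\<epsilon>::real. \<epsilon> > 0 \<longrightarrow>
        (\<exists>g\<in>G. Lp_norm \<Omega> p (\<lambda>x. f x - g x) < ennreal \<epsilon>))"

end

(*
  Let J(w) be the modular of w with |w| replaced by its smoothing sqrt (1 + w^2), so that J is
  strictly convex and differentiable even where p = 1.  On a compact K take f - v_n, with v_n in
  the span of the functions x -> sigma (w . x + b), minimizing J.  Strict convexity makes a
  subsequence converge almost everywhere to some u, and the derivative of J at u is a function in
  L^q(K) orthogonal to the span.  As sigma is discriminatory, u = 0, and testing minimality along
  the rays towards f then shows inf J = 0.  No duality theory is needed.

  That the truncated sums lie in L^p at all follows from the integrability of their products with
  all h in L^q (a gliding hump argument); compactly supported functions are dense in L^p since p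
  is bounded.
*)
theory Submission
  imports Defs
begin

section \<open>A smooth, strictly convex substitute for \<open>\<bar>u\<bar> powr p\<close>\<close>

text \<open>The obstacle is that p may equal 1 or come arbitrarily close to it. The space then need
  not be reflexive, a minimizing sequence may lose part of its modular in the limit, and J itself
  does not pass to the limit. What does pass is the first-order term:
  \<open>soft_power_deriv\<close> has growth of order p - 1 only, so its integral against one fixed
  function of finite modular converges once the modulars stay bounded and the functions converge
  almost everywhere. The argument is arranged so that limits are taken only of such integrals. On
  the ray towards f the direction v_n varies with n, but with u_n = f - v_n one has u_n + t v_n = f
  - (1 - t) v_n, and convexity bounds J there by the derivative tested against the fixed f, plus a
  term that near-minimality controls.

  Almost everywhere convergence is obtained through \<open>soft_sgn\<close>, a bounded transform in
  which strict convexity can be quantified uniformly in p.\<close>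

definition soft_abs :: "real \<Rightarrow> real" where
  "soft_abs u = sqrt (1 + u\<^sup>2)"

text \<open>Subtracting 1 makes the function vanish at 0, so that the infimum to be reached is 0;
  dividing by p removes the factor p from the derivative.\<close>

definition soft_power :: "real \<Rightarrow> real \<Rightarrow> real" where
  "soft_power p u = (soft_abs u powr p - 1) / p"

definition soft_power_deriv :: "real \<Rightarrow> real \<Rightarrow> real" where
  "soft_power_deriv p u = u * soft_abs u powr (p - 2)"

text \<open>This is \<open>soft_power_deriv 1\<close>, a homeomorphism of the reals onto the open
  interval from -1 to 1.\<close>

definition soft_sgn :: "real \<Rightarrow> real" where
  "soft_sgn u = u / soft_abs u"

lemma soft_abs_ge_1: "1 \<le> soft_abs u"
  by (simp add: soft_abs_def)

lemma soft_abs_pos [simp]: "0 < soft_abs u"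
  using soft_abs_ge_1[of u] by linarith

lemma soft_abs_nonzero [simp]: "soft_abs u \<noteq> 0"
  using soft_abs_pos[of u] by linarith

lemma soft_abs_square: "(soft_abs u)\<^sup>2 = 1 + u\<^sup>2"
  by (simp add: soft_abs_def)

lemma soft_abs_mult_powr: "soft_abs u * soft_abs u powr q = soft_abs u powr (q + 1)"
  by (simp add: powr_mult_base less_imp_le add.commute)

lemma soft_abs_minus [simp]: "soft_abs (- u) = soft_abs u"
  by (simp add: soft_abs_def)

lemma soft_abs_0 [simp]: "soft_abs 0 = 1"
  by (simp add: soft_abs_def)

lemma abs_le_soft_abs: "\<bar>u\<bar> \<le> soft_abs u"
  unfolding soft_abs_def by (rule real_le_rsqrt) simp

lemma soft_abs_le: "soft_abs u \<le> 1 + \<bar>u\<bar>"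
  unfolding soft_abs_def by (rule real_le_lsqrt) (auto simp: power2_eq_square algebra_simps)

lemma soft_abs_mono: "\<bar>u\<bar> \<le> \<bar>v\<bar> \<Longrightarrow> soft_abs u \<le> soft_abs v"
  by (simp add: soft_abs_def abs_le_square_iff)

lemma soft_abs_add_le: "soft_abs (a + b) \<le> soft_abs a + soft_abs b"
proof (rule power2_le_imp_le)
  have "a * b \<le> \<bar>a\<bar> * \<bar>b\<bar>" by (metis abs_ge_self abs_mult)
  also have "\<dots> \<le> soft_abs a * soft_abs b"
    by (intro mult_mono abs_le_soft_abs) (auto simp: less_imp_le)
  finally have "a * b \<le> soft_abs a * soft_abs b" .
  then show "(soft_abs (a + b))\<^sup>2 \<le> (soft_abs a + soft_abs b)\<^sup>2"
    by (simp add: power2_sum soft_abs_square)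
qed (simp add: add_nonneg_nonneg less_imp_le)

lemma DERIV_soft_abs: "(soft_abs has_real_derivative u / soft_abs u) (at u)"
proof -
  have "0 < 1 + u\<^sup>2" by (simp add: add_pos_nonneg)
  then show ?thesis
  unfolding soft_abs_def[abs_def]
  by (auto intro!: derivative_eq_intros simp: field_simps)
qed

lemma DERIV_soft_power:
  assumes "p \<noteq> 0"
  shows "(soft_power p has_real_derivative soft_power_deriv p u) (at u)"
proof -
  have *: "soft_abs u powr (p - 1) = soft_abs u * soft_abs u powr (p - 2)"
    by (simp add: soft_abs_mult_powr)
  show ?thesis
    unfolding soft_power_def[abs_def] soft_power_deriv_def
    using assms
    by (auto intro!: derivative_eq_intros DERIV_soft_abs simp: *)
qed

text \<open>The second factor is the square of \<open>soft_abs u\<close> plus (p - 2) times the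
  square of u; in this form positivity for p >= 1 is visible.\<close>

lemma DERIV_soft_power_deriv:
  "(soft_power_deriv p has_real_derivative soft_abs u powr (p - 4) * (1 + (p - 1) * u\<^sup>2)) (at u)"
proof -
  have 1: "soft_abs u powr (p - 3) = soft_abs u * soft_abs u powr (p - 4)"
    by (simp add: soft_abs_mult_powr)
  have "soft_abs u powr (p - 2) = soft_abs u * soft_abs u powr (p - 3)"
    by (simp add: soft_abs_mult_powr)
  then have 2: "soft_abs u powr (p - 2) = (1 + u\<^sup>2) * soft_abs u powr (p - 4)"
    by (simp add: 1 flip: soft_abs_square power2_eq_square mult.assoc)
  show ?thesis
    unfolding soft_power_deriv_def[abs_def]
    by (rule derivative_eq_intros DERIV_soft_abs refl | simp)+
       (simp add: 1 2 field_simps power2_eq_square)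
qed

lemma DERIV_soft_sgn: "(soft_sgn has_real_derivative soft_abs u powr (-3)) (at u)"
proof -
  have "soft_sgn = soft_power_deriv 1"
    by (auto simp: soft_sgn_def soft_power_deriv_def powr_minus less_imp_le divide_inverse)
  then show ?thesis using DERIV_soft_power_deriv[of 1 u] by simp
qed

lemma soft_sgn_mono: "a \<le> b \<Longrightarrow> soft_sgn a \<le> soft_sgn b"
  by (rule DERIV_nonneg_imp_nondecreasing) (use DERIV_soft_sgn in force)+

lemma soft_sgn_minus [simp]: "soft_sgn (- u) = - soft_sgn u"
  by (simp add: soft_sgn_def)

lemma abs_soft_sgn_less_1: "\<bar>soft_sgn u\<bar> < 1"
proof -
  have "\<bar>u\<bar> < soft_abs u"
    unfolding soft_abs_def by (rule real_less_rsqrt) simp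
  then show ?thesis by (simp add: soft_sgn_def abs_divide)
qed

text \<open>Explicit inverse of \<open>soft_sgn\<close>, by which convergence of the transformed
  sequence is carried back to the sequence itself.\<close>

lemma soft_sgn_inverse: "soft_sgn u / sqrt (1 - (soft_sgn u)\<^sup>2) = u"
proof -
  have "1 - (soft_sgn u)\<^sup>2 = 1 / (soft_abs u)\<^sup>2"
    by (simp add: soft_sgn_def power_divide field_simps) (simp add: soft_abs_square)
  then have "sqrt (1 - (soft_sgn u)\<^sup>2) = 1 / soft_abs u"
    by (simp add: real_sqrt_divide less_imp_le)
  then show ?thesis by (simp add: soft_sgn_def)
qed

lemma soft_power_deriv_minus [simp]: "soft_power_deriv p (- u) = - soft_power_deriv p u"
  by (simp add: soft_power_deriv_def)

lemma soft_power_minus [simp]: "soft_power p (- u) = soft_power p u"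
  by (simp add: soft_power_def)

lemma soft_power_0 [simp]: "soft_power p 0 = 0"
  by (simp add: soft_power_def)

lemma soft_power_deriv_0 [simp]: "soft_power_deriv p 0 = 0"
  by (simp add: soft_power_deriv_def)

lemma soft_power_deriv_eq_0_iff [simp]: "soft_power_deriv p u = 0 \<longleftrightarrow> u = 0"
  by (simp add: soft_power_deriv_def)

lemma soft_abs_powr_eq: "p \<noteq> 0 \<Longrightarrow> soft_abs u powr p = 1 + p * soft_power p u"
  by (simp add: soft_power_def)

section \<open>Strict convexity, uniformly in the exponent\<close>

lemma soft_sgn_diff_le:
  assumes "1 \<le> p" "a \<le> b"
  shows "soft_sgn b - soft_sgn a \<le> soft_power_deriv p b - soft_power_deriv p a"
proof -
  have "soft_power_deriv p a - soft_sgn a \<le> soft_power_deriv p b - soft_sgn b"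
  proof (rule DERIV_nonneg_imp_nondecreasing[OF assms(2)], intro exI conjI)
    fix x
    show "((\<lambda>x. soft_power_deriv p x - soft_sgn x) has_real_derivative
        soft_abs x powr (p - 4) * (1 + (p - 1) * x\<^sup>2) - soft_abs x powr (-3)) (at x)"
      by (intro DERIV_diff DERIV_soft_power_deriv DERIV_soft_sgn)
    \<comment> \<open>Exponent 1 is the least convex case: as \<open>soft_abs x\<close> is at least
      1, the second derivative for p dominates the one for 1, which is
      \<open>soft_abs x powr (-3)\<close>.\<close>
    have "soft_abs x powr (-3) \<le> soft_abs x powr (p - 4)"
      using assms(1) soft_abs_ge_1 by (intro powr_mono) auto
    also have "\<dots> \<le> soft_abs x powr (p - 4) * (1 + (p - 1) * x\<^sup>2)"
      using assms(1) by (simp add: mult_le_cancel_left1)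
    finally show "0 \<le> soft_abs x powr (p - 4) * (1 + (p - 1) * x\<^sup>2) - soft_abs x powr (-3)"
      by simp
  qed
  then show ?thesis by simp
qed

text \<open>For fixed b the difference of the two sides vanishes at a = b. To the right of b its
  derivative in a is nonnegative, because increments of \<open>soft_power_deriv p\<close> dominate
  those of \<open>soft_sgn\<close>.\<close>

lemma soft_power_bregman_ge:
  assumes "1 \<le> p"
  shows "(soft_sgn a - soft_sgn b)\<^sup>2 / 2
    \<le> soft_power p a - soft_power p b - soft_power_deriv p b * (a - b)"
proof -
  have *: "(soft_sgn a - soft_sgn b)\<^sup>2 / 2
      \<le> soft_power p a - soft_power p b - soft_power_deriv p b * (a - b)" if "b \<le> a" for a b
  proof -
    define G where "G a = soft_power p a - soft_power p b - soft_power_deriv p b * (a - b)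
      - (soft_sgn a - soft_sgn b)\<^sup>2 / 2" for a
    have "G b \<le> G a"
    proof (rule DERIV_nonneg_imp_nondecreasing[OF that], intro exI conjI)
      fix x assume "b \<le> x"
      show "(G has_real_derivative soft_power_deriv p x - soft_power_deriv p b
          - (soft_sgn x - soft_sgn b) * soft_abs x powr (-3)) (at x)"
        unfolding G_def[abs_def] using assms
        by (auto intro!: derivative_eq_intros DERIV_soft_power DERIV_soft_sgn)
      have "(soft_sgn x - soft_sgn b) * soft_abs x powr (-3) \<le> (soft_sgn x - soft_sgn b) * 1"
      proof (rule mult_left_mono)
        show "soft_abs x powr - 3 \<le> 1"
          using powr_mono[of "-3" 0 "soft_abs x"] soft_abs_ge_1[of x] by simp
      qed (use soft_sgn_mono \<open>b \<le> x\<close> in auto)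
      also have "\<dots> \<le> soft_power_deriv p x - soft_power_deriv p b"
        using soft_sgn_diff_le[OF assms \<open>b \<le> x\<close>] by simp
      finally show "0 \<le> soft_power_deriv p x - soft_power_deriv p b
          - (soft_sgn x - soft_sgn b) * soft_abs x powr (-3)" by simp
    qed
    then show ?thesis by (simp add: G_def)
  qed
  show ?thesis
  proof (cases "b \<le> a")
    case False
    \<comment> \<open>\<open>soft_power\<close> is even, \<open>soft_power_deriv\<close> and
      \<open>soft_sgn\<close> are odd, so reflection reduces this case to the previous one.\<close>
    then show ?thesis using *[of "-b" "-a"]
      by (simp add: power2_commute algebra_simps)
  qed (rule *)
qed

lemma soft_power_convex:
  assumes "1 \<le> p"
  shows "soft_power p b + soft_power_deriv p b * (a - b) \<le> soft_power p a"
  using soft_power_bregman_ge[OF assms, of a b] zero_le_power2[of "soft_sgn a - soft_sgn b"]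
  by linarith

text \<open>The previous bound, with both endpoints compared to the tangent at the midpoint: the
  linear terms cancel on averaging.\<close>

lemma soft_power_midpoint:
  assumes "1 \<le> p"
  shows "(soft_sgn a - soft_sgn b)\<^sup>2 / 8
    \<le> soft_power p a / 2 + soft_power p b / 2 - soft_power p ((a + b) / 2)"
proof -
  let ?m = "(a + b) / 2"
  have "(soft_sgn a - soft_sgn b)\<^sup>2
      \<le> 2 * (soft_sgn a - soft_sgn ?m)\<^sup>2 + 2 * (soft_sgn b - soft_sgn ?m)\<^sup>2"
    using zero_le_power2[of "(soft_sgn a - soft_sgn ?m) + (soft_sgn b - soft_sgn ?m)"]
    by (simp add: power2_eq_square algebra_simps)
  moreover have "soft_power_deriv p ?m * (a - ?m) + soft_power_deriv p ?m * (b - ?m) = 0"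
    by (simp add: field_simps)
  ultimately show ?thesis
    using soft_power_bregman_ge[OF assms, of a ?m] soft_power_bregman_ge[OF assms, of b ?m]
    by argo
qed

lemma soft_power_nonneg: "0 < p \<Longrightarrow> 0 \<le> soft_power p u"
  by (simp add: soft_power_def ge_one_powr_ge_zero soft_abs_ge_1)

lemma soft_power_le_deriv: "1 \<le> p \<Longrightarrow> soft_power p u \<le> soft_power_deriv p u * u"
  using soft_power_convex[of p u 0] by simp

text \<open>This growth puts the derivative into the conjugate space: for p > 1 its power p / (p -
  1) is at most \<open>soft_abs u powr p\<close>, and for p = 1 the bound is 1.\<close>

lemma abs_soft_power_deriv_le: "\<bar>soft_power_deriv p u\<bar> \<le> soft_abs u powr (p - 1)"
proof -
  have "soft_abs u powr (p - 1) = soft_abs u * soft_abs u powr (p - 2)"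
    by (simp add: soft_abs_mult_powr)
  then show ?thesis
    by (simp add: soft_power_deriv_def abs_mult mult_right_mono abs_le_soft_abs)
qed

section \<open>Comparison of powers for exponents up to P\<close>

lemma powr_add_le:
  fixes a b p P :: real
  assumes "0 \<le> a" "0 \<le> b" "0 \<le> p" "p \<le> P"
  shows "(a + b) powr p \<le> 2 powr P * (a powr p + b powr p)"
proof -
  have "(a + b) powr p \<le> (2 * max a b) powr p"
    using assms by (intro powr_mono2) auto
  also have "\<dots> = 2 powr p * max a b powr p"
    using assms by (simp add: powr_mult)
  also have "\<dots> \<le> 2 powr P * (a powr p + b powr p)"
    using assms by (intro mult_mono powr_mono) (auto simp: max_def)
  finally show ?thesis .
qed

text \<open>A Young inequality with parameter \<eta> that avoids the conjugate exponent and so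
  includes p = 1: either y is small against u and the product is absorbed by the first term, or u is
  at most y / \<eta> in size.\<close>

lemma soft_abs_powr_mult_le:
  assumes "1 \<le> p" "p \<le> P" "0 < \<eta>" "\<eta> \<le> 1"
  shows "soft_abs u powr (p - 1) * \<bar>y\<bar>
    \<le> \<eta> * soft_abs u powr p + (1 / \<eta>) powr P * \<bar>y\<bar> powr p"
proof (cases "\<bar>y\<bar> \<le> \<eta> * soft_abs u")
  case True
  then have "soft_abs u powr (p - 1) * \<bar>y\<bar> \<le> soft_abs u powr (p - 1) * (\<eta> * soft_abs u)"
    by (intro mult_left_mono) auto
  also have "\<dots> = \<eta> * soft_abs u powr p"
    using soft_abs_mult_powr[of u "p - 1"] by (simp add: mult_ac)
  finally show ?thesis by (simp add: add_increasing2)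
next
  case False
  then have "\<eta> * soft_abs u < \<bar>y\<bar>" by simp
  then have y: "0 < \<bar>y\<bar>" "soft_abs u \<le> 1 / \<eta> * \<bar>y\<bar>"
    using assms(3) mult_pos_pos[OF assms(3) soft_abs_pos[of u]]
    by (linarith, simp add: field_simps)
  have "soft_abs u powr (p - 1) \<le> (1 / \<eta> * \<bar>y\<bar>) powr (p - 1)"
    using y assms by (intro powr_mono2) (auto simp: less_imp_le)
  also have "\<dots> = (1 / \<eta>) powr (p - 1) * \<bar>y\<bar> powr (p - 1)"
    using assms by (subst powr_mult) auto
  also have "\<dots> \<le> (1 / \<eta>) powr P * \<bar>y\<bar> powr (p - 1)"
    using assms by (intro mult_right_mono powr_mono) auto
  finally have "soft_abs u powr (p - 1) * \<bar>y\<bar> \<le> (1 / \<eta>) powr P * (\<bar>y\<bar> powr (p - 1) * \<bar>y\<bar>)"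
    by (simp add: mult_right_mono flip: mult.assoc)
  also have "\<bar>y\<bar> powr (p - 1) * \<bar>y\<bar> = \<bar>y\<bar> powr p"
    using y(1) powr_mult_base[of "\<bar>y\<bar>" "p - 1"] by (simp add: mult.commute)
  finally show ?thesis
    using assms(3) by (simp add: add_increasing)
qed

text \<open>Leads back from the smoothed modular to the true one. The additive \<eta> is essential
  for p < 2, since \<open>soft_power\<close> is only quadratic near 0; beyond \<eta>, subtracting 1
  from \<open>soft_abs u powr p\<close> costs at most the fraction 1 /
  \<open>soft_abs \<eta>\<close> of it.\<close>

lemma abs_powr_le_soft_power:
  assumes "1 \<le> p" "p \<le> P" "0 < \<eta>" "\<eta> \<le> 1"
  shows "\<bar>u\<bar> powr p \<le> \<eta> + P / (1 - 1 / soft_abs \<eta>) * soft_power p u"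
proof (cases "\<bar>u\<bar> \<le> \<eta>")
  case True
  have "soft_abs \<eta> > 1" using assms(3) by (simp add: soft_abs_def)
  then have "0 \<le> P / (1 - 1 / soft_abs \<eta>) * soft_power p u"
    using assms by (intro mult_nonneg_nonneg soft_power_nonneg) auto
  moreover have "\<bar>u\<bar> powr p \<le> \<eta> powr p" using True assms by (intro powr_mono2) auto
  moreover have "\<eta> powr p \<le> \<eta> powr 1" using assms by (intro powr_mono') auto
  ultimately show ?thesis using assms by simp
next
  case False
  have s: "soft_abs \<eta> > 1" using assms(3) by (simp add: soft_abs_def)
  have "soft_abs \<eta> \<le> soft_abs u" using False assms by (intro soft_abs_mono) auto
  also have "\<dots> \<le> soft_abs u powr p"
    using powr_mono[of 1 p "soft_abs u"] assms soft_abs_ge_1[of u] by simp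
  finally have "1 \<le> soft_abs u powr p / soft_abs \<eta>" by simp
  then have "soft_abs u powr p * (1 - 1 / soft_abs \<eta>) \<le> soft_abs u powr p - 1"
    by (simp add: algebra_simps)
  also have "\<dots> = p * soft_power p u" using assms by (simp add: soft_power_def)
  also have "\<dots> \<le> P * soft_power p u"
    using assms by (intro mult_right_mono soft_power_nonneg) auto
  finally have "soft_abs u powr p \<le> P / (1 - 1 / soft_abs \<eta>) * soft_power p u"
    using s by (simp add: field_simps)
  moreover have "\<bar>u\<bar> powr p \<le> soft_abs u powr p"
    using assms by (intro powr_mono2 abs_le_soft_abs) auto
  ultimately show ?thesis using assms by linarith
qed

lemma soft_abs_measurable [measurable]: "soft_abs \<in> borel_measurable borel"
  unfolding soft_abs_def[abs_def] by measurable

lemma tendsto_soft_abs [tendsto_intros]: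
  "(f \<longlongrightarrow> l) F \<Longrightarrow> ((\<lambda>x. soft_abs (f x)) \<longlongrightarrow> soft_abs l) F"
  unfolding soft_abs_def by (intro tendsto_intros)

lemma soft_sgn_measurable [measurable]: "soft_sgn \<in> borel_measurable borel"
  unfolding soft_sgn_def[abs_def] by measurable

lemma soft_power_measurable [measurable (raw)]:
  assumes [measurable]: "p \<in> borel_measurable M" "u \<in> borel_measurable M"
  shows "(\<lambda>x. soft_power (p x) (u x)) \<in> borel_measurable M"
    "(\<lambda>x. soft_power_deriv (p x) (u x)) \<in> borel_measurable M"
  unfolding soft_power_def soft_power_deriv_def by measurable

section \<open>Bounded exponents on a finite measure space\<close>

locale bounded_exponent_measure = finite_measure M for M :: "'a measure" +
  fixes p :: "'a \<Rightarrow> real" and P :: real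
  assumes p_measurable [measurable]: "p \<in> borel_measurable M"
    and p_ge_1: "x \<in> space M \<Longrightarrow> 1 \<le> p x"
    and p_le: "x \<in> space M \<Longrightarrow> p x \<le> P"
    and P_ge_1: "1 \<le> P"
begin

text \<open>As \<^term>\<open>M\<close> is finite, using \<^const>\<open>soft_abs\<close> in place of the absolute value
  does not change the space.\<close>

definition finite_modular :: "('a \<Rightarrow> real) set" where
  "finite_modular = {f \<in> borel_measurable M. integrable M (\<lambda>x. soft_abs (f x) powr p x)}"

lemma finite_modular_measurable [measurable_dest]:
  "f \<in> finite_modular \<Longrightarrow> f \<in> borel_measurable M"
  by (simp add: finite_modular_def)

lemma finite_modular_integrable:
  "f \<in> finite_modular \<Longrightarrow> integrable M (\<lambda>x. soft_abs (f x) powr p x)"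
  by (simp add: finite_modular_def)

lemma finite_modular_bound:
  assumes [measurable]: "f \<in> borel_measurable M" and "integrable M g"
    and "\<And>x. x \<in> space M \<Longrightarrow> soft_abs (f x) powr p x \<le> g x"
  shows "f \<in> finite_modular"
  unfolding finite_modular_def
proof (intro CollectI conjI assms(1))
  show "integrable M (\<lambda>x. soft_abs (f x) powr p x)"
    by (rule Bochner_Integration.integrable_bound[OF assms(2)]) (use assms(3) in force)+
qed

lemma integrable_abs_powr:
  assumes f: "f \<in> finite_modular"
  shows "integrable M (\<lambda>x. \<bar>f x\<bar> powr p x)"
proof (rule Bochner_Integration.integrable_bound[OF finite_modular_integrable[OF f]])
  show "(\<lambda>x. \<bar>f x\<bar> powr p x) \<in> borel_measurable M"
    using f by measurable
  show "AE x in M. norm (\<bar>f x\<bar> powr p x) \<le> norm (soft_abs (f x) powr p x)"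
    using p_ge_1 by (intro AE_I2) (auto intro!: powr_mono2 abs_le_soft_abs intro: order_trans[OF zero_le_one])
qed

lemma finite_modularI:
  assumes [measurable]: "f \<in> borel_measurable M"
    and "integrable M (\<lambda>x. \<bar>f x\<bar> powr p x)"
  shows "f \<in> finite_modular"
proof (rule finite_modular_bound)
  show "integrable M (\<lambda>x. 2 powr P * (1 + \<bar>f x\<bar> powr p x))"
    using assms(2) by auto
  fix x assume x: "x \<in> space M"
  have "soft_abs (f x) powr p x \<le> (1 + \<bar>f x\<bar>) powr p x"
    using p_ge_1[OF x] by (intro powr_mono2 soft_abs_le) (auto simp: less_imp_le)
  also have "\<dots> \<le> 2 powr P * (1 + \<bar>f x\<bar> powr p x)"
    using powr_add_le[of 1 "\<bar>f x\<bar>" "p x" P] p_ge_1[OF x] p_le[OF x] by simp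
  finally show "soft_abs (f x) powr p x \<le> 2 powr P * (1 + \<bar>f x\<bar> powr p x)" .
qed measurable

lemma soft_abs_powr_add_le:
  assumes "x \<in> space M" "soft_abs c \<le> soft_abs a + soft_abs b"
  shows "soft_abs c powr p x \<le> 2 powr P * (soft_abs a powr p x + soft_abs b powr p x)"
proof -
  have "soft_abs c powr p x \<le> (soft_abs a + soft_abs b) powr p x"
    using p_ge_1[OF assms(1)] assms(2) by (intro powr_mono2) (auto simp: less_imp_le)
  also have "\<dots> \<le> 2 powr P * (soft_abs a powr p x + soft_abs b powr p x)"
    using p_ge_1[OF assms(1)] p_le[OF assms(1)] by (intro powr_add_le) (auto simp: less_imp_le)
  finally show ?thesis .
qed

text \<open>Stated for any dominated h rather than for the sum, because it also serves for f + t g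
  with 0 <= t <= 1, where the bound must not depend on t.\<close>

lemma finite_modular_add_bound:
  assumes fg: "f \<in> finite_modular" "g \<in> finite_modular" and [measurable]: "h \<in> borel_measurable M"
    and le: "\<And>x. x \<in> space M \<Longrightarrow> soft_abs (h x) \<le> soft_abs (f x) + soft_abs (g x)"
  shows "h \<in> finite_modular"
    and "(\<integral>x. soft_abs (h x) powr p x \<partial>M)
      \<le> 2 powr P * ((\<integral>x. soft_abs (f x) powr p x \<partial>M) + (\<integral>x. soft_abs (g x) powr p x \<partial>M))"
proof -
  note int = fg[THEN finite_modular_integrable]
  show h: "h \<in> finite_modular"
    by (rule finite_modular_bound[where
          g = "\<lambda>x. 2 powr P * (soft_abs (f x) powr p x + soft_abs (g x) powr p x)"])
      (use le int in \<open>auto intro: soft_abs_powr_add_le\<close>)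
  have "(\<integral>x. soft_abs (h x) powr p x \<partial>M)
      \<le> (\<integral>x. 2 powr P * (soft_abs (f x) powr p x + soft_abs (g x) powr p x) \<partial>M)"
    using int h by (intro integral_mono soft_abs_powr_add_le le) (auto intro: finite_modular_integrable)
  then show "(\<integral>x. soft_abs (h x) powr p x \<partial>M)
      \<le> 2 powr P * ((\<integral>x. soft_abs (f x) powr p x \<partial>M) + (\<integral>x. soft_abs (g x) powr p x \<partial>M))"
    using int by simp
qed

lemma finite_modular_add:
  assumes "f \<in> finite_modular" "g \<in> finite_modular"
  shows "(\<lambda>x. f x + g x) \<in> finite_modular"
  using assms by (intro finite_modular_add_bound(1)[OF assms]) (auto intro: soft_abs_add_le)

lemma finite_modular_scale:
  assumes f: "f \<in> finite_modular"
  shows "(\<lambda>x. c * f x) \<in> finite_modular"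
proof (rule finite_modularI)
  show "integrable M (\<lambda>x. \<bar>c * f x\<bar> powr p x)"
  proof (rule Bochner_Integration.integrable_bound)
    show "integrable M (\<lambda>x. (1 + \<bar>c\<bar>) powr P * \<bar>f x\<bar> powr p x)"
      using integrable_abs_powr[OF f] by simp
    show "AE x in M. norm (\<bar>c * f x\<bar> powr p x) \<le> norm ((1 + \<bar>c\<bar>) powr P * \<bar>f x\<bar> powr p x)"
    proof (rule AE_I2)
      fix x assume x: "x \<in> space M"
      have "\<bar>c\<bar> powr p x \<le> (1 + \<bar>c\<bar>) powr p x"
        using p_ge_1[OF x] by (intro powr_mono2) auto
      also have "\<dots> \<le> (1 + \<bar>c\<bar>) powr P"
        using p_le[OF x] by (intro powr_mono) auto
      finally show "norm (\<bar>c * f x\<bar> powr p x) \<le> norm ((1 + \<bar>c\<bar>) powr P * \<bar>f x\<bar> powr p x)"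
        by (simp add: abs_mult powr_mult mult_right_mono)
    qed
  qed (use f in measurable)
qed (use f in measurable)

lemma finite_modular_diff:
  assumes "f \<in> finite_modular" "g \<in> finite_modular"
  shows "(\<lambda>x. f x - g x) \<in> finite_modular"
  using finite_modular_add[OF assms(1) finite_modular_scale[OF assms(2), of "-1"]] by simp

lemma finite_modular_0: "(\<lambda>x. 0) \<in> finite_modular"
  by (simp add: finite_modular_def)

lemma integrable_soft_power:
  assumes f: "f \<in> finite_modular"
  shows "integrable M (\<lambda>x. soft_power (p x) (f x))"
proof (rule Bochner_Integration.integrable_bound[OF finite_modular_integrable[OF f]])
  show "(\<lambda>x. soft_power (p x) (f x)) \<in> borel_measurable M"
    using f by measurable
  show "AE x in M. norm (soft_power (p x) (f x)) \<le> norm (soft_abs (f x) powr p x)"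
  proof (rule AE_I2)
    fix x assume x: "x \<in> space M"
    note p_ge_1[OF x]
    moreover have "soft_power (p x) (f x) \<le> p x * soft_power (p x) (f x)"
      using p_ge_1[OF x] soft_power_nonneg[of "p x" "f x"] by (simp add: mult_le_cancel_right1)
    ultimately show "norm (soft_power (p x) (f x)) \<le> norm (soft_abs (f x) powr p x)"
      using soft_power_nonneg[of "p x" "f x"] by (simp add: soft_abs_powr_eq)
  qed
qed

lemma abs_soft_power_deriv_mult_le:
  assumes "x \<in> space M" "0 < \<eta>" "\<eta> \<le> 1"
  shows "\<bar>soft_power_deriv (p x) u * y\<bar>
    \<le> \<eta> * soft_abs u powr p x + (1 / \<eta>) powr P * \<bar>y\<bar> powr p x"
proof -
  have "\<bar>soft_power_deriv (p x) u * y\<bar> \<le> soft_abs u powr (p x - 1) * \<bar>y\<bar>"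
    by (simp add: abs_mult mult_right_mono abs_soft_power_deriv_le)
  also have "\<dots> \<le> \<eta> * soft_abs u powr p x + (1 / \<eta>) powr P * \<bar>y\<bar> powr p x"
    using assms p_ge_1 p_le by (intro soft_abs_powr_mult_le) auto
  finally show ?thesis .
qed

lemma integrable_soft_power_deriv_mult:
  assumes f: "f \<in> finite_modular" and g: "g \<in> finite_modular"
  shows "integrable M (\<lambda>x. soft_power_deriv (p x) (f x) * g x)"
proof (rule Bochner_Integration.integrable_bound)
  show "integrable M (\<lambda>x. soft_abs (f x) powr p x + \<bar>g x\<bar> powr p x)"
    using finite_modular_integrable[OF f] integrable_abs_powr[OF g] by simp
  show "(\<lambda>x. soft_power_deriv (p x) (f x) * g x) \<in> borel_measurable M"
    using f g by measurable
  show "AE x in M. norm (soft_power_deriv (p x) (f x) * g x)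
      \<le> norm (soft_abs (f x) powr p x + \<bar>g x\<bar> powr p x)"
    using abs_soft_power_deriv_mult_le[of _ 1] by (intro AE_I2) simp
qed

section \<open>Passage to the limit under bounded modulars\<close>

lemma finite_modular_limit:
  assumes w: "\<And>n. w n \<in> finite_modular"
    and C: "\<And>n. (\<integral>x. soft_abs (w n x) powr p x \<partial>M) \<le> C"
    and u[measurable]: "u \<in> borel_measurable M"
    and lim: "AE x in M. (\<lambda>n. w n x) \<longlonglongrightarrow> u x"
  shows "u \<in> finite_modular" "(\<integral>x. soft_abs (u x) powr p x \<partial>M) \<le> C"
proof -
  have [measurable]: "w n \<in> borel_measurable M" for n
    using w by measurable
  have C0: "0 \<le> C"
    using C[of 0] by (rule order_trans[rotated]) (auto intro: integral_nonneg)
  have "(\<integral>\<^sup>+x. ennreal (soft_abs (u x) powr p x) \<partial>M)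
      = (\<integral>\<^sup>+x. liminf (\<lambda>n. ennreal (soft_abs (w n x) powr p x)) \<partial>M)"
  proof (rule nn_integral_cong_AE, use lim in eventually_elim)
    fix x assume "(\<lambda>n. w n x) \<longlonglongrightarrow> u x"
    then have "(\<lambda>n. ennreal (soft_abs (w n x) powr p x)) \<longlonglongrightarrow> ennreal (soft_abs (u x) powr p x)"
      by (intro tendsto_intros) auto
    then show "ennreal (soft_abs (u x) powr p x) = liminf (\<lambda>n. ennreal (soft_abs (w n x) powr p x))"
      by (rule lim_imp_Liminf[OF trivial_limit_sequentially, symmetric])
  qed
  also have "\<dots> \<le> liminf (\<lambda>n. \<integral>\<^sup>+x. ennreal (soft_abs (w n x) powr p x) \<partial>M)"
    by (rule nn_integral_liminf) simp
  also have "\<dots> = liminf (\<lambda>n. ennreal (\<integral>x. soft_abs (w n x) powr p x \<partial>M))"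
    using w by (subst nn_integral_eq_integral) (auto intro: finite_modular_integrable)
  also have "\<dots> \<le> liminf (\<lambda>n. ennreal C)"
    using C by (intro Liminf_mono always_eventually allI ennreal_leI)
  also have "\<dots> = ennreal C"
    by (simp add: Liminf_const)
  finally have le: "(\<integral>\<^sup>+x. ennreal (soft_abs (u x) powr p x) \<partial>M) \<le> ennreal C" .
  have "integrable M (\<lambda>x. soft_abs (u x) powr p x)"
    using le by (intro integrableI_bounded) (auto intro: le_less_trans)
  then show *: "u \<in> finite_modular"
    by (simp add: finite_modular_def)
  show "(\<integral>x. soft_abs (u x) powr p x \<partial>M) \<le> C"
    using le C0 by (subst (asm) nn_integral_eq_integral) (auto intro: finite_modular_integrable *)
qed

text \<open>No convergence of \<open>w n\<close> in modular is available. Young's inequality with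
  small \<eta> makes the integrands uniformly integrable: up to \<eta> times the bounded modulars
  they are dominated by a multiple of \<open>\<bar>\<phi> x\<bar> powr p x\<close>.\<close>

lemma tendsto_integral_soft_power_deriv:
  assumes w: "\<And>n. w n \<in> finite_modular"
    and C: "\<And>n. (\<integral>x. soft_abs (w n x) powr p x \<partial>M) \<le> C"
    and [measurable]: "u \<in> borel_measurable M"
    and lim: "AE x in M. (\<lambda>n. w n x) \<longlonglongrightarrow> u x"
    and \<phi>: "\<phi> \<in> finite_modular"
  shows "(\<lambda>n. \<integral>x. soft_power_deriv (p x) (w n x) * \<phi> x \<partial>M)
    \<longlonglongrightarrow> (\<integral>x. soft_power_deriv (p x) (u x) * \<phi> x \<partial>M)"
proof -
  have [measurable]: "w n \<in> borel_measurable M" "\<phi> \<in> borel_measurable M" for n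
    using w \<phi> by measurable
  note u = finite_modular_limit[OF w C assms(3) lim]
  have C0: "0 \<le> C"
    using C[of 0] by (rule order_trans[rotated]) (auto intro: integral_nonneg)
  define A where "A n x = \<bar>soft_power_deriv (p x) (w n x) * \<phi> x - soft_power_deriv (p x) (u x) * \<phi> x\<bar>" for n x
  have [measurable]: "A n \<in> borel_measurable M" for n
    unfolding A_def[abs_def] by measurable
  have intA: "integrable M (A n)" for n
    unfolding A_def[abs_def]
    by (intro integrable_abs Bochner_Integration.integrable_diff integrable_soft_power_deriv_mult w u \<phi>)
  have "(\<lambda>n. \<integral>x. A n x \<partial>M) \<longlonglongrightarrow> 0"
  proof (rule LIMSEQ_I)
    fix e :: real assume e: "0 < e"
    \<comment> \<open>Chosen so that the two modulars, of \<open>w n\<close> and of u, together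
      contribute at most e / 2.\<close>
    define \<eta> where "\<eta> = min 1 (e / (4 * (C + 1)))"
    have \<eta>: "0 < \<eta>" "\<eta> \<le> 1" "2 * \<eta> * C \<le> e / 2"
    proof -
      have "2 * \<eta> * C \<le> 2 * (e / (4 * (C + 1))) * C"
        using C0 e by (intro mult_right_mono mult_left_mono) (auto simp: \<eta>_def)
      also have "\<dots> \<le> e / 2" using C0 e by (simp add: field_simps)
      finally show "2 * \<eta> * C \<le> e / 2" .
    qed (use C0 e in \<open>auto simp: \<eta>_def\<close>)
    define G where "G x = 2 * ((1 / \<eta>) powr P * \<bar>\<phi> x\<bar> powr p x)" for x
    have intG: "integrable M G"
      unfolding G_def[abs_def] using integrable_abs_powr[OF \<phi>] by simp
    then have [measurable]: "G \<in> borel_measurable M" by measurable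
    have G0: "0 \<le> G x" for x by (simp add: G_def)
    \<comment> \<open>\<open>G\<close> collects the Young terms in \<phi>, which are independent of
      n. Below \<open>G\<close> dominated convergence applies; the excess of \<open>A n\<close> over
      \<open>G\<close> is left to \<eta>.\<close>
    have "(\<lambda>n. \<integral>x. min (A n x) (G x) \<partial>M) \<longlonglongrightarrow> (\<integral>x. 0 \<partial>M)"
    proof (rule integral_dominated_convergence[OF _ _ intG])
      show "AE x in M. (\<lambda>n. min (A n x) (G x)) \<longlonglongrightarrow> 0"
        using lim
      proof eventually_elim
        fix x assume lim: "(\<lambda>n. w n x) \<longlonglongrightarrow> u x"
        have "(\<lambda>n. A n x) \<longlonglongrightarrow> \<bar>soft_power_deriv (p x) (u x) * \<phi> x - soft_power_deriv (p x) (u x) * \<phi> x\<bar>"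
          unfolding A_def soft_power_deriv_def
          by (intro tendsto_intros lim) auto
        then have "(\<lambda>n. A n x) \<longlonglongrightarrow> 0" by simp
        then show "(\<lambda>n. min (A n x) (G x)) \<longlonglongrightarrow> 0"
          by (rule tendsto_sandwich[OF _ _ tendsto_const, rotated 2])
             (auto simp: A_def G0 intro!: always_eventually)
      qed
    qed (auto simp: A_def G0)
    then have "\<forall>\<^sub>F n in sequentially. (\<integral>x. min (A n x) (G x) \<partial>M) < e / 2"
      using e by (intro order_tendstoD) auto
    then obtain N where N: "\<And>n. N \<le> n \<Longrightarrow> (\<integral>x. min (A n x) (G x) \<partial>M) < e / 2"
      by (auto simp: eventually_sequentially)
    show "\<exists>N. \<forall>n\<ge>N. norm ((\<integral>x. A n x \<partial>M) - 0) < e"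
    proof (intro exI allI impI)
      fix n assume n: "N \<le> n"
      have "(\<integral>x. A n x \<partial>M) \<le> (\<integral>x. min (A n x) (G x)
          + \<eta> * (soft_abs (w n x) powr p x + soft_abs (u x) powr p x) \<partial>M)"
      proof (rule integral_mono[OF intA])
        show "integrable M (\<lambda>x. min (A n x) (G x)
            + \<eta> * (soft_abs (w n x) powr p x + soft_abs (u x) powr p x))"
          by (intro Bochner_Integration.integrable_add integrable_mult_right integrable_min intA intG
              finite_modular_integrable w u)
        fix x assume x: "x \<in> space M"
        have "A n x \<le> \<bar>soft_power_deriv (p x) (w n x) * \<phi> x\<bar> + \<bar>soft_power_deriv (p x) (u x) * \<phi> x\<bar>"
          unfolding A_def by (rule abs_triangle_ineq4)
        also have "\<dots> \<le> \<eta> * (soft_abs (w n x) powr p x + soft_abs (u x) powr p x) + G x"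
          using abs_soft_power_deriv_mult_le[OF x \<eta>(1,2), of "w n x" "\<phi> x"]
            abs_soft_power_deriv_mult_le[OF x \<eta>(1,2), of "u x" "\<phi> x"]
          unfolding G_def by (simp add: algebra_simps)
        finally have "A n x \<le> \<eta> * (soft_abs (w n x) powr p x + soft_abs (u x) powr p x) + G x" .
        moreover have "0 \<le> \<eta> * (soft_abs (w n x) powr p x + soft_abs (u x) powr p x)"
          using \<eta> by simp
        ultimately show "A n x \<le> min (A n x) (G x)
            + \<eta> * (soft_abs (w n x) powr p x + soft_abs (u x) powr p x)"
          by (simp add: min_def)
      qed
      also have "\<dots> = (\<integral>x. min (A n x) (G x) \<partial>M)
          + \<eta> * ((\<integral>x. soft_abs (w n x) powr p x \<partial>M) + (\<integral>x. soft_abs (u x) powr p x \<partial>M))"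
        using finite_modular_integrable[OF w] finite_modular_integrable[OF u(1)] intA intG
        by simp
      also have "\<dots> \<le> (\<integral>x. min (A n x) (G x) \<partial>M) + \<eta> * (C + C)"
        using \<eta> C u(2) by (intro add_left_mono mult_left_mono add_mono) auto
      also have "\<dots> < e"
        using N[OF n] \<eta>(3) by (simp add: algebra_simps)
      finally show "norm ((\<integral>x. A n x \<partial>M) - 0) < e"
        by (simp add: A_def)
    qed
  qed
  then have "(\<lambda>n. (\<integral>x. soft_power_deriv (p x) (w n x) * \<phi> x \<partial>M)
      - (\<integral>x. soft_power_deriv (p x) (u x) * \<phi> x \<partial>M)) \<longlonglongrightarrow> 0"
  proof (rule Lim_null_comparison[rotated], intro always_eventually allI)
    fix n
    show "norm ((\<integral>x. soft_power_deriv (p x) (w n x) * \<phi> x \<partial>M)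
      - (\<integral>x. soft_power_deriv (p x) (u x) * \<phi> x \<partial>M)) \<le> (\<integral>x. A n x \<partial>M)"
      unfolding A_def real_norm_def
      by (subst Bochner_Integration.integral_diff[symmetric])
         (auto intro!: integral_abs_bound integrable_soft_power_deriv_mult w u \<phi>)
  qed
  then show ?thesis by (simp add: LIM_zero_iff)
qed

section \<open>Minimizing sequences and approximation\<close>

text \<open>An infimum over an affine subspace need not be attained (the exponent may be 1), but a
  minimizing sequence still converges almost everywhere along a subsequence, because
  \<^const>\<open>soft_sgn\<close> of it is Cauchy in mean square by strict convexity.\<close>

lemma minimizing_sequence_converges:
  fixes u :: "nat \<Rightarrow> 'a \<Rightarrow> real"
  assumes u: "\<And>n. u n \<in> finite_modular"
    and upper: "\<And>n. (\<integral>x. soft_power (p x) (u n x) \<partial>M) \<le> d + \<epsilon> n"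
    and lower: "\<And>m n. d \<le> (\<integral>x. soft_power (p x) ((u m x + u n x) / 2) \<partial>M)"
    and \<epsilon>: "\<epsilon> \<longlonglongrightarrow> 0"
    and C: "\<And>n. (\<integral>x. soft_abs (u n x) powr p x \<partial>M) \<le> C"
  obtains r v where "strict_mono r" "v \<in> borel_measurable M"
    "AE x in M. (\<lambda>n. u (r n) x) \<longlonglongrightarrow> v x"
proof -
  have [measurable]: "u n \<in> borel_measurable M" for n
    using u by measurable
  have bnd: "\<bar>soft_sgn a - soft_sgn b\<bar> \<le> 2" for a b
    using abs_soft_sgn_less_1[of a] abs_soft_sgn_less_1[of b] by linarith
  have int1: "integrable M (\<lambda>x. soft_sgn (u n x))" for n
    by (rule integrable_const_bound[of _ 1]) (auto intro: less_imp_le abs_soft_sgn_less_1)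
  have int2: "integrable M (\<lambda>x. (soft_sgn (u m x) - soft_sgn (u n x))\<^sup>2)" for m n
  proof (rule integrable_const_bound[of _ 4])
    show "AE x in M. norm ((soft_sgn (u m x) - soft_sgn (u n x))\<^sup>2) \<le> 4"
      using power_mono[OF bnd abs_ge_zero, of _ _ 2] by (intro AE_I2) simp
  qed measurable
  have half: "(\<lambda>x. (u m x + u n x) / 2) \<in> finite_modular" for m n
    using finite_modular_scale[OF finite_modular_add[OF u u], of "1/2" m n] by simp
  \<comment> \<open>Integrated midpoint inequality: the average of the two values is at most d plus
    half of \<epsilon> m + \<epsilon> n, the value at the midpoint is at least d, and the factor 8
    turns the half into 4.\<close>
  have sq: "(\<integral>x. (soft_sgn (u m x) - soft_sgn (u n x))\<^sup>2 \<partial>M) \<le> 4 * (\<epsilon> m + \<epsilon> n)" for m n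
  proof -
    have "(\<integral>x. (soft_sgn (u m x) - soft_sgn (u n x))\<^sup>2 / 8 \<partial>M)
        \<le> (\<integral>x. soft_power (p x) (u m x) / 2 + soft_power (p x) (u n x) / 2
            - soft_power (p x) ((u m x + u n x) / 2) \<partial>M)"
      using int2 u half p_ge_1
      by (intro integral_mono soft_power_midpoint Bochner_Integration.integrable_diff
          Bochner_Integration.integrable_add integrable_divide_zero integrable_soft_power) auto
    also have "\<dots> = (\<integral>x. soft_power (p x) (u m x) \<partial>M) / 2 + (\<integral>x. soft_power (p x) (u n x) \<partial>M) / 2
        - (\<integral>x. soft_power (p x) ((u m x + u n x) / 2) \<partial>M)"
      using integrable_soft_power[OF u] integrable_soft_power[OF half] by simp
    finally show ?thesis
      using upper[of m] upper[of n] lower[of m n] by simp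
  qed
  have cauchy: "\<exists>N. \<forall>i\<ge>N. \<forall>j\<ge>N. (LINT x|M. norm (soft_sgn (u i x) - soft_sgn (u j x))) < e"
    if e: "0 < e" for e
  proof -
    define \<eta> where "\<eta> = e / (2 * (measure M (space M) + 1))"
    have mpos: "0 < measure M (space M) + 1" by (simp add: add_nonneg_pos)
    then have \<eta>: "0 < \<eta>" using e by (simp add: \<eta>_def)
    have "\<eta> * measure M (space M) \<le> \<eta> * (measure M (space M) + 1)" using \<eta> by simp
    also have "\<dots> = e / 2" using mpos by (simp add: \<eta>_def field_simps)
    finally have \<eta>2: "\<eta> * measure M (space M) \<le> e / 2" .
    have "\<forall>\<^sub>F n in sequentially. \<epsilon> n < e * \<eta> / 16"
      using \<epsilon> e \<eta> by (intro order_tendstoD) auto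
    then obtain N where N: "\<And>n. N \<le> n \<Longrightarrow> \<epsilon> n < e * \<eta> / 16"
      by (auto simp: eventually_sequentially)
    have "(LINT x|M. norm (soft_sgn (u i x) - soft_sgn (u j x))) < e" if "N \<le> i" "N \<le> j" for i j
    proof -
      \<comment> \<open>Passes from mean square to the L1 distance that the subsequence lemma asks
        for. With \<epsilon> below e * \<eta> / 16 at both indices the second term integrates to
        less than e / 2.\<close>
      have le: "\<bar>y\<bar> \<le> \<eta> + y\<^sup>2 / \<eta>" for y :: real
      proof (cases "\<bar>y\<bar> \<le> \<eta>")
        case False
        then have "\<eta> * \<bar>y\<bar> \<le> \<bar>y\<bar> * \<bar>y\<bar>" by (intro mult_right_mono) auto
        then have "\<bar>y\<bar> \<le> y\<^sup>2 / \<eta>" using \<eta> by (simp add: field_simps power2_eq_square)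
        then show ?thesis using \<eta> by simp
      qed (use \<eta> in \<open>simp add: add_increasing2\<close>)
      have "(LINT x|M. norm (soft_sgn (u i x) - soft_sgn (u j x)))
          \<le> (\<integral>x. \<eta> + (soft_sgn (u i x) - soft_sgn (u j x))\<^sup>2 / \<eta> \<partial>M)"
        using int1 int2 le by (intro integral_mono) auto
      also have "\<dots> = \<eta> * measure M (space M) + (\<integral>x. (soft_sgn (u i x) - soft_sgn (u j x))\<^sup>2 \<partial>M) / \<eta>"
        using int2 by simp
      also have "\<dots> \<le> e / 2 + 4 * (\<epsilon> i + \<epsilon> j) / \<eta>"
        using \<eta> \<eta>2 sq by (intro add_mono divide_right_mono) auto
      also have "\<dots> < e"
        using N[OF that(1)] N[OF that(2)] \<eta> by (simp add: field_simps)
      finally show ?thesis .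
    qed
    then show ?thesis by blast
  qed
  obtain r where r: "strict_mono r" and Cau: "AE x in M. Cauchy (\<lambda>n. soft_sgn (u (r n) x))"
    using cauchy_L1_AE_cauchy_subseq[where s = "\<lambda>n x. soft_sgn (u n x)", OF int1 cauchy] by blast
  have "(\<integral>\<^sup>+x. liminf (\<lambda>n. ennreal (soft_abs (u (r n) x) powr p x)) \<partial>M)
      \<le> liminf (\<lambda>n. \<integral>\<^sup>+x. ennreal (soft_abs (u (r n) x) powr p x) \<partial>M)"
    by (rule nn_integral_liminf) simp
  also have "\<dots> = liminf (\<lambda>n. ennreal (\<integral>x. soft_abs (u (r n) x) powr p x \<partial>M))"
    using u by (subst nn_integral_eq_integral) (auto intro: finite_modular_integrable)
  also have "\<dots> \<le> liminf (\<lambda>n. ennreal C)"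
    using C by (intro Liminf_mono always_eventually allI ennreal_leI)
  also have "\<dots> < \<infinity>"
    by (simp add: Liminf_const)
  \<comment> \<open>By Fatou. Convergence of \<open>soft_sgn\<close> alone would allow the limits 1
    and -1, that is, escape of the sequence to infinity; this bound excludes it.\<close>
  finally have fin: "AE x in M. liminf (\<lambda>n. ennreal (soft_abs (u (r n) x) powr p x)) \<noteq> \<infinity>"
    by (intro nn_integral_PInf_AE) auto
  have "AE x in M. convergent (\<lambda>n. u (r n) x)"
    using Cau fin AE_space
  proof eventually_elim
    fix x assume Cau: "Cauchy (\<lambda>n. soft_sgn (u (r n) x))"
      and fin: "liminf (\<lambda>n. ennreal (soft_abs (u (r n) x) powr p x)) \<noteq> \<infinity>" and x: "x \<in> space M"
    obtain \<tau> where \<tau>: "(\<lambda>n. soft_sgn (u (r n) x)) \<longlonglongrightarrow> \<tau>"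
      using Cau by (auto simp: Cauchy_convergent_iff convergent_def)
    obtain B where B: "liminf (\<lambda>n. ennreal (soft_abs (u (r n) x) powr p x)) < ennreal B" "1 \<le> B"
    proof -
      from fin obtain B where "liminf (\<lambda>n. ennreal (soft_abs (u (r n) x) powr p x)) = ennreal B" "0 \<le> B"
        by (cases "liminf (\<lambda>n. ennreal (soft_abs (u (r n) x) powr p x))") auto
      then show ?thesis
        by (intro that[of "B + 1"]) (auto simp: ennreal_lessI)
    qed
    \<comment> \<open>A finite liminf bounds \<open>soft_abs\<close> by \<open>B\<close> only
      infinitely often. That suffices: \<open>soft_sgn\<close> converges along the whole
      subsequence, so its limit \<tau> inherits the resulting distance from 1 and -1.\<close>
    have freq: "\<exists>\<^sub>F n in sequentially. soft_abs (u (r n) x) < B"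
    proof (rule ccontr)
      assume "\<not> ?thesis"
      then have "\<forall>\<^sub>F n in sequentially. B \<le> soft_abs (u (r n) x)"
        by (simp add: not_frequently not_less)
      then have "\<forall>\<^sub>F n in sequentially. ennreal B \<le> ennreal (soft_abs (u (r n) x) powr p x)"
      proof eventually_elim
        case (elim n)
        also have "soft_abs (u (r n) x) \<le> soft_abs (u (r n) x) powr p x"
          using powr_mono[of 1 "p x" "soft_abs (u (r n) x)"] p_ge_1[OF x] soft_abs_ge_1[of "u (r n) x"]
          by simp
        finally show ?case by (rule ennreal_leI)
      qed
      then have "ennreal B \<le> liminf (\<lambda>n. ennreal (soft_abs (u (r n) x) powr p x))"
        by (rule Liminf_bounded)
      with B show False by simp
    qed
    have eq: "1 - (soft_sgn a)\<^sup>2 = 1 / (soft_abs a)\<^sup>2" for a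
      by (simp add: soft_sgn_def power_divide field_simps) (simp add: soft_abs_square)
    have "1 / B\<^sup>2 \<le> 1 - \<tau>\<^sup>2"
    proof (rule ccontr)
      assume "\<not> ?thesis"
      moreover have "(\<lambda>n. 1 - (soft_sgn (u (r n) x))\<^sup>2) \<longlonglongrightarrow> 1 - \<tau>\<^sup>2"
        by (intro tendsto_intros \<tau>)
      ultimately have "\<forall>\<^sub>F n in sequentially. 1 - (soft_sgn (u (r n) x))\<^sup>2 < 1 / B\<^sup>2"
        by (intro order_tendstoD) auto
      from frequently_ex[OF frequently_eventually_frequently[OF freq this]]
      obtain a where a: "soft_abs a < B" "1 - (soft_sgn a)\<^sup>2 < 1 / B\<^sup>2"
        by blast
      have "(soft_abs a)\<^sup>2 \<le> B\<^sup>2"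
        using a(1) by (intro power_mono) (auto simp: less_imp_le)
      then have "1 / B\<^sup>2 \<le> 1 / (soft_abs a)\<^sup>2"
        using B(2) by (intro divide_left_mono) auto
      with a(2) show False by (simp add: eq)
    qed
    moreover have "0 < 1 / B\<^sup>2" using B by simp
    ultimately have "0 < 1 - \<tau>\<^sup>2" by linarith
    then have "(\<lambda>n. soft_sgn (u (r n) x) / sqrt (1 - (soft_sgn (u (r n) x))\<^sup>2))
        \<longlonglongrightarrow> \<tau> / sqrt (1 - \<tau>\<^sup>2)"
      by (intro tendsto_intros \<tau>) auto
    then show "convergent (\<lambda>n. u (r n) x)"
      by (auto simp: soft_sgn_inverse convergent_def)
  qed
  then show ?thesis
    by (intro that[of r "\<lambda>x. lim (\<lambda>n. u (r n) x)"] r borel_measurable_lim_metric)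
       (auto simp: convergent_LIMSEQ_iff)
qed

text \<open>This replaces Hahn-Banach and the representation of the dual space: if the distance from
  \<^term>\<open>f\<close> to \<^term>\<open>V\<close> is positive, the derivative of the modular at the limit of a minimizing
  sequence is a nonzero annihilator of \<^term>\<open>V\<close>.\<close>

theorem approx_if_annihilators_trivial:
  assumes V: "V \<subseteq> finite_modular" "(\<lambda>x. 0) \<in> V"
    and V_add: "\<And>v w. v \<in> V \<Longrightarrow> w \<in> V \<Longrightarrow> (\<lambda>x. v x + w x) \<in> V"
    and V_scale: "\<And>c v. v \<in> V \<Longrightarrow> (\<lambda>x. c * v x) \<in> V"
    and ann: "\<And>u. u \<in> finite_modular \<Longrightarrow>
      (\<And>\<phi>. \<phi> \<in> V \<Longrightarrow> (\<integral>x. soft_power_deriv (p x) (u x) * \<phi> x \<partial>M) = 0) \<Longrightarrow> AE x in M. u x = 0"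
    and f: "f \<in> finite_modular" and e: "0 < e"
  shows "\<exists>v\<in>V. (\<integral>x. soft_power (p x) (f x - v x) \<partial>M) < e"
proof -
  define J where "J w = (\<integral>x. soft_power (p x) (w x) \<partial>M)" for w
  have J0: "0 \<le> J w" for w
    unfolding J_def using p_ge_1
    by (intro Bochner_Integration.integral_nonneg soft_power_nonneg) (auto intro: less_le_trans[OF zero_less_one])
  define d where "d = (INF v\<in>V. J (\<lambda>x. f x - v x))"
  have bdd: "bdd_below ((\<lambda>v. J (\<lambda>x. f x - v x)) ` V)"
    using J0 by (intro bdd_belowI2[where m = 0])
  have lower: "d \<le> J (\<lambda>x. f x - v x)" if "v \<in> V" for v
    unfolding d_def using that by (intro cINF_lower bdd)
  define t where "t n = 1 / (real n + 1)" for n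
  have t: "0 < t n" "t n \<le> 1" for n
    by (auto simp: t_def)
  \<comment> \<open>The error is the square of the step size \<open>t n\<close> used below, so that
    dividing by the step still leaves an error tending to 0.\<close>
  have "\<exists>v\<in>V. J (\<lambda>x. f x - v x) < d + (t n)\<^sup>2" for n
  proof -
    have "d < d + (t n)\<^sup>2" using t(1)[of n] by simp
    then show ?thesis
      unfolding d_def using V(2) by (subst (asm) cINF_less_iff) (auto intro: bdd)
  qed
  then obtain v where v: "\<And>n. v n \<in> V" and Jv: "\<And>n. J (\<lambda>x. f x - v n x) < d + (t n)\<^sup>2"
    by metis
  define u where "u n x = f x - v n x" for n x
  have u: "u n \<in> finite_modular" for n
    unfolding u_def[abs_def] using f v V by (intro finite_modular_diff) auto
  have Ju: "J (u n) < d + (t n)\<^sup>2" for n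
    using Jv[of n] by (simp add: u_def[abs_def])
  have t0: "t \<longlonglongrightarrow> 0"
    unfolding t_def using LIMSEQ_inverse_real_of_nat by (simp add: inverse_eq_divide add.commute)
  \<comment> \<open>From \<open>soft_abs u powr p = 1 + p * soft_power p u\<close> with p at most P,
    and J at most d + 1 along the sequence.\<close>
  define C where "C = measure M (space M) + P * (d + 1)"
  have C: "(\<integral>x. soft_abs (u n x) powr p x \<partial>M) \<le> C" for n
  proof -
    have "(\<integral>x. soft_abs (u n x) powr p x \<partial>M) \<le> (\<integral>x. 1 + P * soft_power (p x) (u n x) \<partial>M)"
    proof (rule integral_mono)
      fix x assume x: "x \<in> space M"
      show "soft_abs (u n x) powr p x \<le> 1 + P * soft_power (p x) (u n x)"
        using p_ge_1[OF x] p_le[OF x] soft_power_nonneg[of "p x" "u n x"]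
        by (simp add: soft_abs_powr_eq mult_right_mono)
    qed (simp_all add: finite_modular_integrable integrable_soft_power u)
    also have "\<dots> = measure M (space M) + P * J (u n)"
      using integrable_soft_power[OF u] by (simp add: J_def)
    also have "\<dots> \<le> C"
    proof -
      have "(t n)\<^sup>2 \<le> 1" using t[of n] by (simp add: power_le_one)
      then show ?thesis
        unfolding C_def using Ju[of n] P_ge_1 by (intro add_left_mono mult_left_mono) auto
    qed
    finally show ?thesis .
  qed
  obtain r w where r: "strict_mono r" and w[measurable]: "w \<in> borel_measurable M"
    and lim: "AE x in M. (\<lambda>n. u (r n) x) \<longlonglongrightarrow> w x"
  proof (rule minimizing_sequence_converges[of u d "\<lambda>n. (t n)\<^sup>2" C])
    show "d \<le> (\<integral>x. soft_power (p x) ((u m x + u n x) / 2) \<partial>M)" for m n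
    proof -
      have "(\<lambda>x. (1 / 2) * (v m x + v n x)) \<in> V"
        using v by (intro V_scale V_add)
      from lower[OF this] have "d \<le> J (\<lambda>x. f x - (1 / 2) * (v m x + v n x))" .
      also have "(\<lambda>x. f x - (1 / 2) * (v m x + v n x)) = (\<lambda>x. (u m x + u n x) / 2)"
        by (simp add: u_def fun_eq_iff field_simps)
      finally show ?thesis by (simp add: J_def)
    qed
    show "(\<lambda>n. (t n)\<^sup>2) \<longlonglongrightarrow> 0"
      using tendsto_power[OF t0, of 2] by simp
  qed (use u C Ju in \<open>auto simp: J_def less_imp_le\<close>)
  note w_fm = finite_modular_limit[OF u C w lim]
  define \<tau> where "\<tau> n = t (r n)" for n
  have \<tau>: "0 < \<tau> n" "\<tau> n \<le> 1" for n
    using t by (auto simp: \<tau>_def)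
  have \<tau>0: "\<tau> \<longlonglongrightarrow> 0"
    using LIMSEQ_subseq_LIMSEQ[OF t0 r] by (simp add: \<tau>_def[abs_def] comp_def)
  \<comment> \<open>First-order condition for a near-minimizer. The tangent is taken at the
    perturbed point, so convexity alone gives the estimate and nothing is differentiated under the
    integral.\<close>
  have variation: "- \<tau> n \<le> (\<integral>x. soft_power_deriv (p x) (u (r n) x + \<tau> n * \<phi> x) * \<phi> x \<partial>M)"
    if \<phi>: "\<phi> \<in> V" for \<phi> n
  proof -
    have \<phi>L: "\<phi> \<in> finite_modular" using \<phi> V by auto
    let ?w = "\<lambda>x. u (r n) x + \<tau> n * \<phi> x"
    have wL: "?w \<in> finite_modular"
      by (intro finite_modular_add finite_modular_scale u \<phi>L)
    have "(\<lambda>x. v (r n) x + (- \<tau> n) * \<phi> x) \<in> V"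
      by (intro V_add V_scale v \<phi>)
    from lower[OF this] have "d \<le> J ?w"
      by (simp add: u_def[abs_def] algebra_simps)
    moreover have "J ?w - \<tau> n * (\<integral>x. soft_power_deriv (p x) (?w x) * \<phi> x \<partial>M) \<le> J (u (r n))"
    proof -
      have "(\<integral>x. soft_power (p x) (?w x) - \<tau> n * (soft_power_deriv (p x) (?w x) * \<phi> x) \<partial>M) \<le> J (u (r n))"
        unfolding J_def
      proof (rule integral_mono)
        fix x assume x: "x \<in> space M"
        show "soft_power (p x) (?w x) - \<tau> n * (soft_power_deriv (p x) (?w x) * \<phi> x)
            \<le> soft_power (p x) (u (r n) x)"
          using soft_power_convex[OF p_ge_1[OF x], of "?w x" "u (r n) x"] by (simp add: algebra_simps)
      qed (intro Bochner_Integration.integrable_diff integrable_mult_right integrable_soft_power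
          integrable_soft_power_deriv_mult wL u \<phi>L)+
      then show ?thesis
        unfolding J_def
        by (subst (asm) Bochner_Integration.integral_diff)
          (auto intro!: integrable_mult_right integrable_soft_power integrable_soft_power_deriv_mult wL \<phi>L)
    qed
    moreover have "J (u (r n)) < d + \<tau> n * \<tau> n"
      using Ju[of "r n"] by (simp add: \<tau>_def power2_eq_square)
    ultimately have "\<tau> n * (- \<tau> n) \<le> \<tau> n * (\<integral>x. soft_power_deriv (p x) (?w x) * \<phi> x \<partial>M)"
      by simp
    then show ?thesis
      using \<tau>(1)[of n] by (simp only: mult_le_cancel_left_pos)
  qed
  have nonneg: "0 \<le> (\<integral>x. soft_power_deriv (p x) (w x) * \<phi> x \<partial>M)" if \<phi>: "\<phi> \<in> V" for \<phi>
  proof (rule LIMSEQ_le)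
    have \<phi>L: "\<phi> \<in> finite_modular" using \<phi> V by auto
    then have [measurable]: "\<phi> \<in> borel_measurable M" by measurable
    have wn: "soft_abs (u (r n) x + \<tau> n * \<phi> x) \<le> soft_abs (u (r n) x) + soft_abs (\<phi> x)" for n x
    proof -
      have "soft_abs (\<tau> n * \<phi> x) \<le> soft_abs (\<phi> x)"
        using \<tau>[of n] by (intro soft_abs_mono) (simp add: abs_mult mult_left_le_one_le)
      then show ?thesis
        using soft_abs_add_le[of "u (r n) x" "\<tau> n * \<phi> x"] by linarith
    qed
    show "(\<lambda>n. - \<tau> n) \<longlonglongrightarrow> 0" using tendsto_minus[OF \<tau>0] by simp
    show "\<exists>N. \<forall>n\<ge>N. - \<tau> n \<le> (\<integral>x. soft_power_deriv (p x) (u (r n) x + \<tau> n * \<phi> x) * \<phi> x \<partial>M)"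
      using variation[OF \<phi>] by blast
    show "(\<lambda>n. \<integral>x. soft_power_deriv (p x) (u (r n) x + \<tau> n * \<phi> x) * \<phi> x \<partial>M)
        \<longlonglongrightarrow> (\<integral>x. soft_power_deriv (p x) (w x) * \<phi> x \<partial>M)"
    proof (rule tendsto_integral_soft_power_deriv)
      fix n
      show wL: "(\<lambda>x. u (r n) x + \<tau> n * \<phi> x) \<in> finite_modular"
        by (intro finite_modular_add finite_modular_scale u \<phi>L)
      show "(\<integral>x. soft_abs (u (r n) x + \<tau> n * \<phi> x) powr p x \<partial>M)
          \<le> 2 powr P * (C + (\<integral>x. soft_abs (\<phi> x) powr p x \<partial>M))"
        proof -
      have "(\<integral>x. soft_abs (u (r n) x + \<tau> n * \<phi> x) powr p x \<partial>M)
          \<le> 2 powr P * ((\<integral>x. soft_abs (u (r n) x) powr p x \<partial>M) + (\<integral>x. soft_abs (\<phi> x) powr p x \<partial>M))"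
        by (rule finite_modular_add_bound(2)[OF u \<phi>L finite_modular_measurable[OF wL] wn])
      also have "\<dots> \<le> 2 powr P * (C + (\<integral>x. soft_abs (\<phi> x) powr p x \<partial>M))"
        using C[of "r n"] by (intro mult_left_mono add_right_mono) auto
      finally show ?thesis .
    qed
    next
      show "AE x in M. (\<lambda>n. u (r n) x + \<tau> n * \<phi> x) \<longlonglongrightarrow> w x"
        using lim
      proof eventually_elim
        fix x assume "(\<lambda>n. u (r n) x) \<longlonglongrightarrow> w x"
        from tendsto_add[OF this tendsto_mult[OF \<tau>0 tendsto_const]]
        show "(\<lambda>n. u (r n) x + \<tau> n * \<phi> x) \<longlonglongrightarrow> w x" by simp
      qed
    qed (use \<phi>L in auto)
  qed
  have "AE x in M. w x = 0"
  proof (rule ann[OF w_fm(1)])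
    fix \<phi> assume \<phi>: "\<phi> \<in> V"
    show "(\<integral>x. soft_power_deriv (p x) (w x) * \<phi> x \<partial>M) = 0"
      using nonneg[OF \<phi>] nonneg[OF V_scale[OF \<phi>, of "-1"]] by simp
  qed
  with lim have lim0: "AE x in M. (\<lambda>n. u (r n) x) \<longlonglongrightarrow> 0"
    by eventually_elim simp
  \<comment> \<open>The perturbed point is
    \<open>(1 - \<tau> n) * u (r n) x + \<tau> n * f x\<close>, a step from \<open>u (r n)\<close>
    towards f. Testing against f, which is fixed, makes the limit of \<open>X\<close>
    computable.\<close>
  define X where "X n = (\<integral>x. soft_power_deriv (p x) (u (r n) x + \<tau> n * v (r n) x) * f x \<partial>M)" for n
  have "d \<le> X n + \<tau> n" for n
  proof -
    let ?w = "\<lambda>x. u (r n) x + \<tau> n * v (r n) x"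
    have vL: "v (r n) \<in> finite_modular" using v V by auto
    have wL: "?w \<in> finite_modular"
      by (intro finite_modular_add finite_modular_scale u vL)
    note int = integrable_soft_power_deriv_mult[OF wL]
    define Y where "Y = (\<integral>x. soft_power_deriv (p x) (?w x) * v (r n) x \<partial>M)"
    have "(\<lambda>x. (1 - \<tau> n) * v (r n) x) \<in> V"
      by (intro V_scale v)
    from lower[OF this] have "d \<le> J ?w"
      by (simp add: u_def[abs_def] algebra_simps)
    \<comment> \<open>The tangent at \<open>?w\<close>, evaluated at 0, bounds J by the derivative
      tested against \<open>?w\<close> itself, which is f minus a multiple of
      \<open>v (r n)\<close>.\<close>
    also have "J ?w \<le> (\<integral>x. soft_power_deriv (p x) (?w x) * f x
        - (1 - \<tau> n) * (soft_power_deriv (p x) (?w x) * v (r n) x) \<partial>M)"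
      unfolding J_def
    proof (rule integral_mono)
      fix x assume x: "x \<in> space M"
      have "?w x = f x - (1 - \<tau> n) * v (r n) x" by (simp add: u_def algebra_simps)
      then have "soft_power_deriv (p x) (?w x) * ?w x
          = soft_power_deriv (p x) (?w x) * (f x - (1 - \<tau> n) * v (r n) x)" by simp
      also have "\<dots> = soft_power_deriv (p x) (?w x) * f x
          - (1 - \<tau> n) * (soft_power_deriv (p x) (?w x) * v (r n) x)"
        by (simp only: right_diff_distrib mult.left_commute)
      finally show "soft_power (p x) (?w x) \<le> soft_power_deriv (p x) (?w x) * f x
          - (1 - \<tau> n) * (soft_power_deriv (p x) (?w x) * v (r n) x)"
        using soft_power_le_deriv[OF p_ge_1[OF x], of "?w x"] by (simp only:)
    qed (intro Bochner_Integration.integrable_diff integrable_mult_right integrable_soft_power int wL vL f)+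
    also have "\<dots> = X n - (1 - \<tau> n) * Y"
      unfolding X_def Y_def
      by (subst Bochner_Integration.integral_diff) (auto intro!: integrable_mult_right int vL f)
    \<comment> \<open>The bound in \<open>variation\<close> is the same for all elements of V, so
      the test function may be \<open>v (r n)\<close> with the same n.\<close>
    also have "\<dots> \<le> X n + (1 - \<tau> n) * \<tau> n"
      using mult_left_mono[OF variation[OF v, of n "r n"], of "1 - \<tau> n"] \<tau>(2)[of n]
      by (simp add: Y_def)
    also have "\<dots> \<le> X n + \<tau> n"
      using \<tau>[of n] by (simp add: mult_left_le_one_le)
    finally show ?thesis .
  qed
  \<comment> \<open>The perturbed points still tend to 0 almost everywhere, and the derivative
    vanishes there.\<close>
  moreover have "(\<lambda>n. X n + \<tau> n) \<longlonglongrightarrow> (\<integral>x. soft_power_deriv (p x) 0 * f x \<partial>M) + 0"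
    unfolding X_def
  proof (intro tendsto_add \<tau>0 tendsto_integral_soft_power_deriv[OF _ _ _ _ f])
    fix n
    have eq: "u (r n) x + \<tau> n * v (r n) x = (1 - \<tau> n) * u (r n) x + \<tau> n * f x" for x
      by (simp add: u_def algebra_simps)
    show wL: "(\<lambda>x. u (r n) x + \<tau> n * v (r n) x) \<in> finite_modular"
      using v V by (intro finite_modular_add finite_modular_scale u) auto
    have wn: "soft_abs (u (r n) x + \<tau> n * v (r n) x) \<le> soft_abs (u (r n) x) + soft_abs (f x)" for x
    proof -
      have "soft_abs (\<tau> n * f x) \<le> soft_abs (f x)" "soft_abs ((1 - \<tau> n) * u (r n) x) \<le> soft_abs (u (r n) x)"
        using \<tau>[of n] by (auto intro!: soft_abs_mono simp: abs_mult mult_left_le_one_le)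
      then show ?thesis
        using soft_abs_add_le[of "(1 - \<tau> n) * u (r n) x" "\<tau> n * f x"] by (simp add: eq)
    qed
    show "(\<integral>x. soft_abs (u (r n) x + \<tau> n * v (r n) x) powr p x \<partial>M)
        \<le> 2 powr P * (C + (\<integral>x. soft_abs (f x) powr p x \<partial>M))"
      proof -
      have "(\<integral>x. soft_abs (u (r n) x + \<tau> n * v (r n) x) powr p x \<partial>M)
          \<le> 2 powr P * ((\<integral>x. soft_abs (u (r n) x) powr p x \<partial>M) + (\<integral>x. soft_abs (f x) powr p x \<partial>M))"
        by (rule finite_modular_add_bound(2)[OF u f finite_modular_measurable[OF wL] wn])
      also have "\<dots> \<le> 2 powr P * (C + (\<integral>x. soft_abs (f x) powr p x \<partial>M))"
        using C[of "r n"] by (intro mult_left_mono add_right_mono) auto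
      finally show ?thesis .
    qed
  next
    show "AE x in M. (\<lambda>n. u (r n) x + \<tau> n * v (r n) x) \<longlonglongrightarrow> 0"
      using lim0
    proof eventually_elim
      fix x assume *: "(\<lambda>n. u (r n) x) \<longlonglongrightarrow> 0"
      have "(\<lambda>n. u (r n) x + \<tau> n * (f x - u (r n) x)) \<longlonglongrightarrow> 0 + 0 * (f x - 0)"
        by (intro tendsto_intros \<tau>0 *)
      then show "(\<lambda>n. u (r n) x + \<tau> n * v (r n) x) \<longlonglongrightarrow> 0"
        by (simp add: u_def)
    qed
  qed auto
  then have "(\<lambda>n. X n + \<tau> n) \<longlonglongrightarrow> 0" by simp
  ultimately have "d \<le> 0"
    by (intro LIMSEQ_le_const) auto
  then have "d < e" using e by simp
  then have "\<exists>v\<in>V. J (\<lambda>x. f x - v x) < e"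
    unfolding d_def using V(2) by (subst (asm) cINF_less_iff) (auto intro: bdd)
  then show ?thesis by (simp add: J_def)
qed

text \<open>Half of e pays for the additive \<eta> of \<open>abs_powr_le_soft_power\<close>
  integrated over the finite measure, the other half for the smoothed modular times its
  constant.\<close>

corollary modular_approx_if_annihilators_trivial:
  assumes V: "V \<subseteq> finite_modular" "(\<lambda>x. 0) \<in> V"
    and V_add: "\<And>v w. v \<in> V \<Longrightarrow> w \<in> V \<Longrightarrow> (\<lambda>x. v x + w x) \<in> V"
    and V_scale: "\<And>c v. v \<in> V \<Longrightarrow> (\<lambda>x. c * v x) \<in> V"
    and ann: "\<And>u. u \<in> finite_modular \<Longrightarrow>
      (\<And>\<phi>. \<phi> \<in> V \<Longrightarrow> (\<integral>x. soft_power_deriv (p x) (u x) * \<phi> x \<partial>M) = 0) \<Longrightarrow> AE x in M. u x = 0"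
    and f: "f \<in> finite_modular" and e: "0 < e"
  shows "\<exists>v\<in>V. (\<integral>x. \<bar>f x - v x\<bar> powr p x \<partial>M) < e"
proof -
  define \<eta> where "\<eta> = min 1 (e / (2 * (measure M (space M) + 1)))"
  have mpos: "0 < measure M (space M) + 1" by (simp add: add_nonneg_pos)
  then have \<eta>: "0 < \<eta>" "\<eta> \<le> 1" using e by (auto simp: \<eta>_def)
  have "\<eta> * measure M (space M) \<le> \<eta> * (measure M (space M) + 1)" using \<eta> by simp
  also have "\<dots> \<le> e / (2 * (measure M (space M) + 1)) * (measure M (space M) + 1)"
    using mpos by (intro mult_right_mono) (auto simp: \<eta>_def)
  also have "\<dots> = e / 2" using mpos by (simp add: field_simps)
  finally have \<eta>2: "\<eta> * measure M (space M) \<le> e / 2" .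
  define c where "c = P / (1 - 1 / soft_abs \<eta>)"
  have "1 < soft_abs \<eta>" using \<eta> by (simp add: soft_abs_def)
  then have c: "0 < c" using P_ge_1 by (simp add: c_def)
  obtain v where v: "v \<in> V" and J: "(\<integral>x. soft_power (p x) (f x - v x) \<partial>M) < e / (2 * c)"
  proof -
    have "0 < e / (2 * c)" using e c by simp
    from approx_if_annihilators_trivial[OF V V_add V_scale ann f this] show ?thesis
      using that by blast
  qed
  have u: "(\<lambda>x. f x - v x) \<in> finite_modular"
    using f v V by (intro finite_modular_diff) auto
  have "(\<integral>x. \<bar>f x - v x\<bar> powr p x \<partial>M) \<le> (\<integral>x. \<eta> + c * soft_power (p x) (f x - v x) \<partial>M)"
    unfolding c_def using integrable_soft_power[OF u] p_ge_1 p_le \<eta>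
    by (intro integral_mono integrable_abs_powr[OF u] abs_powr_le_soft_power) simp_all
  also have "\<dots> = \<eta> * measure M (space M) + c * (\<integral>x. soft_power (p x) (f x - v x) \<partial>M)"
    using integrable_soft_power[OF u] by simp
  also have "\<dots> < e / 2 + c * (e / (2 * c))"
    using \<eta>2 J c by (intro add_le_less_mono mult_strict_left_mono) auto
  also have "\<dots> = e" using c by simp
  finally show ?thesis using v by blast
qed

end

section \<open>Functions with integrable products\<close>

context finite_measure
begin

text \<open>The level sets of \<^term>\<open>u\<close> are grouped into blocks whose masses \<open>b k\<close> grow like \<open>2 ^ k\<close>,
  and \<open>c = 1 / b k\<close> on the \<open>k\<close>-th block.\<close>

lemma exists_weight_of_infinite_integral:
  fixes u :: "'a \<Rightarrow> real"
  assumes [measurable]: "u \<in> borel_measurable M" and u0: "\<And>x. 0 \<le> u x"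
    and inf: "(\<integral>\<^sup>+x. ennreal (u x) \<partial>M) = \<infinity>"
  obtains c where "c \<in> borel_measurable M" "\<And>x. 0 < c x" "\<And>x. c x \<le> (1::real)"
    "(\<integral>\<^sup>+x. ennreal (c x * u x) \<partial>M) = \<infinity>"
    "\<And>a. 0 < a \<Longrightarrow> (\<integral>\<^sup>+x. ennreal (c x powr (1 + a) * u x) \<partial>M) < \<infinity>"
proof -
  \<comment> \<open>Mass below level n: finite since the measure is, and unbounded in n by monotone
    convergence.\<close>
  define I where "I n = (\<integral>x. u x * indicator {x. u x < real n} x \<partial>M)" for n
  have int: "integrable M (\<lambda>x. u x * indicator {x. u x < real n} x)" for n
    by (rule integrable_const_bound[of _ "real n"]) (auto simp: u0 indicator_def)
  have mono: "I m \<le> I n" if "m \<le> n" for m n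
    unfolding I_def using that u0 by (intro integral_mono int) (auto simp: indicator_def)
  have unbounded: "\<exists>n. K \<le> I n" for K
  proof (rule ccontr)
    assume "\<not> ?thesis"
    then have K: "I n \<le> K" for n by (meson less_imp_le not_le)
    have "(\<integral>\<^sup>+x. ennreal (u x) \<partial>M) = (\<integral>\<^sup>+x. (SUP n. ennreal (u x * indicator {x. u x < real n} x)) \<partial>M)"
    proof (rule nn_integral_cong)
      fix x
      obtain n where n: "u x < real n" using reals_Archimedean2 by blast
      show "ennreal (u x) = (SUP n. ennreal (u x * indicator {x. u x < real n} x))"
        by (rule antisym, rule SUP_upper2[of n])
           (use n u0 in \<open>auto intro!: SUP_least ennreal_leI simp: indicator_def\<close>)
    qed
    also have "\<dots> = (SUP n. \<integral>\<^sup>+x. ennreal (u x * indicator {x. u x < real n} x) \<partial>M)"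
      using u0 by (intro nn_integral_monotone_convergence_SUP)
        (auto simp: incseq_def le_fun_def indicator_def intro!: ennreal_leI)
    also have "\<dots> = (SUP n. ennreal (I n))"
      unfolding I_def using u0 by (subst nn_integral_eq_integral[OF int]) auto
    also have "\<dots> \<le> ennreal K"
      by (intro SUP_least ennreal_leI K)
    finally show False using inf by (simp add: top_unique)
  qed
  \<comment> \<open>The levels \<open>m k\<close> cut the range of u into blocks of mass at least
    \<open>2 ^ k\<close>; starting at 0 ensures that they cover all values.\<close>
  have "\<exists>m. (m 0 = (0::nat)) \<and> (\<forall>k. m k < m (Suc k) \<and> I (m k) + 2 ^ k \<le> I (m (Suc k)))"
  proof -
    have "\<exists>m. \<forall>k. (k = 0 \<longrightarrow> m k = (0::nat)) \<and> (m k < m (Suc k) \<and> I (m k) + 2 ^ k \<le> I (m (Suc k)))"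
    proof (rule dependent_nat_choice)
      fix x k
      obtain n where n: "I x + 2 ^ k \<le> I n" using unbounded by blast
      also have "I n \<le> I (max n (Suc x))" by (intro mono) auto
      finally show "\<exists>y. (Suc k = 0 \<longrightarrow> y = 0) \<and> x < y \<and> I x + 2 ^ k \<le> I y"
        by (intro exI[of _ "max n (Suc x)"]) auto
    qed auto
    then show ?thesis by blast
  qed
  then obtain m where m0: "m 0 = (0::nat)" and m: "\<And>k. m k < m (Suc k)"
    and mI: "\<And>k. I (m k) + 2 ^ k \<le> I (m (Suc k))" by blast
  have sm: "strict_mono m" using m by (simp add: strict_mono_Suc_iff)
  define b where "b k = I (m (Suc k)) - I (m k)" for k
  have b: "2 ^ k \<le> b k" for k using mI[of k] by (simp add: b_def)
  have b0: "0 < b k" for k using b[of k] by (rule less_le_trans[rotated]) simp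
  define B where "B k = {x. real (m k) \<le> u x \<and> u x < real (m (Suc k))}" for k
  \<comment> \<open>Index of the block containing x, so that every weight constant on blocks is a
    function of \<kappa>.\<close>
  define \<kappa> where "\<kappa> x = (LEAST k. u x < real (m (Suc k)))" for x
  have B_iff: "x \<in> B k \<longleftrightarrow> \<kappa> x = k" for x k
  proof -
    obtain n where "u x < real n" using reals_Archimedean2 by blast
    also have "real n \<le> real (m (Suc n))"
      using strict_mono_imp_increasing[OF sm, of "Suc n"] by linarith
    finally have n: "u x < real (m (Suc n))" .
    show ?thesis
    proof
      assume x: "x \<in> B k"
      show "\<kappa> x = k" unfolding \<kappa>_def
      proof (rule Least_equality)
        fix j assume "u x < real (m (Suc j))"
        with x have "m k < m (Suc j)" by (auto simp: B_def)
        then show "k \<le> j" using sm by (simp add: strict_mono_less)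
      qed (use x in \<open>auto simp: B_def\<close>)
    next
      assume k: "\<kappa> x = k"
      have "real (m k) \<le> u x"
      proof (cases k)
        case (Suc j)
        then have "j < \<kappa> x" using k by simp
        then show ?thesis using not_less_Least[of j "\<lambda>k. u x < real (m (Suc k))"] Suc
          by (simp add: \<kappa>_def)
      qed (use m0 u0 in simp)
      moreover have "u x < real (m (Suc k))"
        using LeastI[of "\<lambda>k. u x < real (m (Suc k))", OF n] k by (simp add: \<kappa>_def)
      ultimately show "x \<in> B k" by (simp add: B_def)
    qed
  qed
  have [measurable]: "B k \<inter> space M \<in> sets M" for k
    unfolding B_def by measurable
  have \<kappa>_meas [measurable]: "\<kappa> \<in> measurable M (count_space UNIV)"
    unfolding \<kappa>_def[abs_def] by measurable
  have mass: "(\<integral>\<^sup>+x. ennreal (u x) * indicator {k} (\<kappa> x) \<partial>M) = ennreal (b k)" for k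
  proof -
    have "(\<integral>\<^sup>+x. ennreal (u x) * indicator {k} (\<kappa> x) \<partial>M)
      = (\<integral>\<^sup>+x. ennreal (u x * indicator {x. u x < real (m (Suc k))} x
          - u x * indicator {x. u x < real (m k)} x) \<partial>M)"
    proof (rule nn_integral_cong)
      fix x
      have "\<kappa> x = k \<longleftrightarrow> real (m k) \<le> u x \<and> u x < real (m (Suc k))"
        using B_iff[of x k] by (simp add: B_def)
      then show "ennreal (u x) * indicator {k} (\<kappa> x) = ennreal (u x * indicator {x. u x < real (m (Suc k))} x
          - u x * indicator {x. u x < real (m k)} x)"
        using m[of k] by (auto simp: indicator_def)
    qed
    also have "\<dots> = ennreal (b k)"
    proof (subst nn_integral_eq_integral[OF Bochner_Integration.integrable_diff[OF int int]])
      show "AE x in M. 0 \<le> u x * indicator {x. u x < real (m (Suc k))} x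
          - u x * indicator {x. u x < real (m k)} x"
        using m[of k] u0 by (intro AE_I2) (auto simp: indicator_def)
    qed (simp only: b_def I_def Bochner_Integration.integral_diff[OF int int])
    finally show ?thesis .
  qed
  have split: "(\<integral>\<^sup>+x. ennreal (G (\<kappa> x) * u x) \<partial>M) = (\<Sum>k. ennreal (G k * b k))"
    if G: "\<And>k. 0 \<le> G k" for G :: "nat \<Rightarrow> real"
  proof -
    have "(\<integral>\<^sup>+x. ennreal (G (\<kappa> x) * u x) \<partial>M)
        = (\<integral>\<^sup>+x. (\<Sum>k. ennreal (G k) * (ennreal (u x) * indicator {k} (\<kappa> x))) \<partial>M)"
    proof (rule nn_integral_cong)
      fix x
      have "(\<Sum>k. ennreal (G k) * (ennreal (u x) * indicator {k} (\<kappa> x)))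
          = (\<Sum>k\<in>{\<kappa> x}. ennreal (G k) * (ennreal (u x) * indicator {k} (\<kappa> x)))"
        by (rule suminf_finite) auto
      then show "ennreal (G (\<kappa> x) * u x)
          = (\<Sum>k. ennreal (G k) * (ennreal (u x) * indicator {k} (\<kappa> x)))"
        using G u0 by (simp add: ennreal_mult)
    qed
    also have "\<dots> = (\<Sum>k. \<integral>\<^sup>+x. ennreal (G k) * (ennreal (u x) * indicator {k} (\<kappa> x)) \<partial>M)"
      by (intro nn_integral_suminf borel_measurable_times_ennreal
          measurable_compose[OF \<kappa>_meas]) simp_all
    also have "\<dots> = (\<Sum>k. ennreal (G k * b k))"
      using G b0
      by (subst nn_integral_cmult, intro borel_measurable_times_ennreal measurable_compose[OF \<kappa>_meas])
         (simp_all add: mass ennreal_mult less_imp_le)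
    finally show ?thesis .
  qed
  show thesis
  proof
    show "(\<lambda>x. 1 / b (\<kappa> x)) \<in> borel_measurable M"
      by (rule measurable_compose[OF \<kappa>_meas]) simp
    show "0 < 1 / b (\<kappa> x)" for x using b0 by simp
    show "1 / b (\<kappa> x) \<le> 1" for x
    proof -
      have "(1::real) \<le> 2 ^ \<kappa> x" by simp
      also have "\<dots> \<le> b (\<kappa> x)" by (rule b)
      finally show ?thesis using b0[of "\<kappa> x"] by simp
    qed
    \<comment> \<open>Every block contributes exactly 1 to the weighted integral, hence divergence.
      With the additional power a the contribution of block k drops to
      \<open>(1 / b k) powr a\<close>, and a geometric series bounds the sum.\<close>
    have "1 / b k * b k = 1" for k using b0[of k] by simp
    then show "(\<integral>\<^sup>+x. ennreal (1 / b (\<kappa> x) * u x) \<partial>M) = \<infinity>"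
      using b0 by (subst split) (auto simp: less_imp_le suminf_eq_SUP ennreal_SUP_of_nat_eq_top)
    fix a :: real assume a: "0 < a"
    have "(1 / b k) powr (1 + a) * b k \<le> ((1 / 2) powr a) ^ k" for k
    proof -
      have "(1 / b k) powr (1 + a) * b k = (1 / b k) powr a"
        using b0[of k] by (simp add: powr_add)
      also have "\<dots> \<le> (1 / 2 ^ k) powr a"
        using b[of k] b0[of k] a by (intro powr_mono2 divide_left_mono) auto
      also have "1 / 2 ^ k = (1 / 2 :: real) powr real k"
        by (simp add: powr_realpow power_one_over)
      also have "((1 / 2 :: real) powr real k) powr a = ((1 / 2) powr a) ^ k"
        by (simp add: powr_powr powr_power mult.commute)
      finally show ?thesis .
    qed
    then have "(\<Sum>k. ennreal ((1 / b k) powr (1 + a) * b k)) \<le> (\<Sum>k. ennreal (((1 / 2) powr a) ^ k))"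
      by (intro suminf_le ennreal_leI) auto
    also have "\<dots> < \<infinity>"
    proof -
      have "(1 / 2) powr a < (1::real)" using powr_less_mono2[OF a, of "1 / 2" 1] by simp
      then show ?thesis
        by (subst suminf_ennreal2) (auto intro!: summable_geometric)
    qed
    finally show "(\<integral>\<^sup>+x. ennreal ((1 / b (\<kappa> x)) powr (1 + a) * u x) \<partial>M) < \<infinity>"
      by (subst split) auto
  qed
qed

end

context bounded_exponent_measure
begin

text \<open>Converse of Hoelder's inequality. If the modular were infinite, h = c * |f|^(p - 1) with
  the weight c above would be admissible, while f * h has the non-integrable absolute value c *
  |f|^p. A single c serves all points because p <= P gives p / (p - 1) >= 1 + 1 / P.\<close>

lemma finite_modular_if_integrable_products:
  assumes [measurable]: "f \<in> borel_measurable M"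
    and prod: "\<And>h. h \<in> borel_measurable M \<Longrightarrow> (\<And>x. x \<in> space M \<Longrightarrow> p x = 1 \<Longrightarrow> \<bar>h x\<bar> \<le> 1) \<Longrightarrow>
      (\<integral>\<^sup>+x. (if p x = 1 then 0 else ennreal (\<bar>h x\<bar> powr (p x / (p x - 1)))) \<partial>M) < \<infinity> \<Longrightarrow>
      integrable M (\<lambda>x. f x * h x)"
  shows "f \<in> finite_modular"
proof (rule finite_modularI[OF assms(1)], rule ccontr)
  assume "\<not> integrable M (\<lambda>x. \<bar>f x\<bar> powr p x)"
  then have "(\<integral>\<^sup>+x. ennreal (\<bar>f x\<bar> powr p x) \<partial>M) = \<infinity>"
    by (simp add: integrable_iff_bounded not_less top_unique)
  then obtain c where [measurable]: "c \<in> borel_measurable M" and c: "\<And>x. 0 < c x" "\<And>x. c x \<le> 1"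
    and inf: "(\<integral>\<^sup>+x. ennreal (c x * \<bar>f x\<bar> powr p x) \<partial>M) = \<infinity>"
    and fin: "\<And>a. 0 < a \<Longrightarrow> (\<integral>\<^sup>+x. ennreal (c x powr (1 + a) * \<bar>f x\<bar> powr p x) \<partial>M) < \<infinity>"
    using exists_weight_of_infinite_integral[of "\<lambda>x. \<bar>f x\<bar> powr p x"] by auto
  define h where "h x = c x * \<bar>f x\<bar> powr (p x - 1)" for x
  have h0: "0 \<le> h x" for x using c(1)[of x] by (simp add: h_def less_imp_le)
  have "integrable M (\<lambda>x. f x * h x)"
  proof (rule prod)
    \<comment> \<open>At exponent 0 \<open>powr\<close> gives 1, or 0 at base 0, so h is at most c
      there.\<close>
    show "\<bar>h x\<bar> \<le> 1" if "x \<in> space M" "p x = 1" for x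
      using c[of x] that by (simp add: h_def abs_mult)
    have "(\<integral>\<^sup>+x. (if p x = 1 then 0 else ennreal (\<bar>h x\<bar> powr (p x / (p x - 1)))) \<partial>M)
        \<le> (\<integral>\<^sup>+x. ennreal (c x powr (1 + 1 / P) * \<bar>f x\<bar> powr p x) \<partial>M)"
    proof (rule nn_integral_mono)
      fix x assume x: "x \<in> space M"
      show "(if p x = 1 then 0 else ennreal (\<bar>h x\<bar> powr (p x / (p x - 1))))
          \<le> ennreal (c x powr (1 + 1 / P) * \<bar>f x\<bar> powr p x)"
      proof (cases "p x = 1")
        case False
        then have px: "1 < p x" "p x \<le> P" using p_ge_1[OF x] p_le[OF x] by auto
        have "\<bar>h x\<bar> powr (p x / (p x - 1)) = c x powr (p x / (p x - 1)) * \<bar>f x\<bar> powr p x"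
          using px c(1)[of x] by (simp add: h_def abs_mult powr_mult powr_powr less_imp_le)
        also have "\<dots> \<le> c x powr (1 + 1 / P) * \<bar>f x\<bar> powr p x"
        proof (intro mult_right_mono powr_mono')
          have "1 / P \<le> 1 / (p x - 1)" using px by (intro divide_left_mono) auto
          also have "\<dots> = p x / (p x - 1) - 1" using px by (simp add: field_simps)
          finally show "1 + 1 / P \<le> p x / (p x - 1)" by simp
        qed (use c[of x] in auto)
        finally show ?thesis using False by (simp add: ennreal_leI)
      qed simp
    qed
    also have "\<dots> < \<infinity>" using P_ge_1 by (intro fin) auto
    finally show "(\<integral>\<^sup>+x. (if p x = 1 then 0 else ennreal (\<bar>h x\<bar> powr (p x / (p x - 1)))) \<partial>M) < \<infinity>" .
  qed (simp add: h_def[abs_def])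
  then have "(\<integral>\<^sup>+x. ennreal (norm (f x * h x)) \<partial>M) < \<infinity>"
    by (simp add: integrable_iff_bounded)
  also have "(\<integral>\<^sup>+x. ennreal (norm (f x * h x)) \<partial>M) = (\<integral>\<^sup>+x. ennreal (c x * \<bar>f x\<bar> powr p x) \<partial>M)"
  proof (rule nn_integral_cong)
    fix x
    have "\<bar>f x\<bar> * \<bar>f x\<bar> powr (p x - 1) = \<bar>f x\<bar> powr p x"
      by (simp add: powr_mult_base)
    then show "ennreal (norm (f x * h x)) = ennreal (c x * \<bar>f x\<bar> powr p x)"
      using h0[of x] by (simp add: abs_mult) (simp add: h_def mult_ac)
  qed
  finally show False using inf by simp
qed

end

section \<open>Variable Lebesgue spaces\<close>

lemma Lp_norm_le:
  assumes "0 < l" "modular \<Omega> p (\<lambda>x. f x / l) \<le> 1"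
  shows "Lp_norm \<Omega> p f \<le> ennreal l"
  unfolding Lp_norm_def luxemburg_norm_def using assms by (intro Inf_lower) auto

lemma modular_cong:
  assumes "\<And>x. x \<in> \<Omega> \<Longrightarrow> f x = g x"
  shows "modular \<Omega> p f = modular \<Omega> p g"
  unfolding modular_def using assms by (intro nn_integral_cong) simp

lemma modular_split:
  assumes sets: "\<Omega> \<in> sets lebesgue" "K \<in> sets lebesgue" "K \<subseteq> \<Omega>"
    and [measurable]: "p \<in> borel_measurable (lebesgue_on \<Omega>)" "f \<in> borel_measurable (lebesgue_on \<Omega>)"
  shows "modular \<Omega> p f = modular K p f + modular (\<Omega> - K) p f"
proof -
  let ?F = "\<lambda>x. ennreal (\<bar>f x\<bar> powr p x)"
  have [measurable]: "K \<in> sets (lebesgue_on \<Omega>)" "\<Omega> - K \<in> sets (lebesgue_on \<Omega>)"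
    using sets by (auto simp: sets_restrict_space_iff)
  have sub: "(\<integral>\<^sup>+x. ?F x * indicator A x \<partial>lebesgue_on \<Omega>) = (\<integral>\<^sup>+x. ?F x \<partial>lebesgue_on A)"
    if "A \<in> sets lebesgue" "A \<subseteq> \<Omega>" for A
    using that sets by (simp add: nn_integral_restrict_space)
      (auto intro!: nn_integral_cong simp: indicator_def)
  have "modular \<Omega> p f = (\<integral>\<^sup>+x. ?F x * indicator K x + ?F x * indicator (\<Omega> - K) x \<partial>lebesgue_on \<Omega>)"
    unfolding modular_def by (intro nn_integral_cong) (auto simp: indicator_def)
  also have "\<dots> = modular K p f + modular (\<Omega> - K) p f"
    unfolding modular_def using sets
    by (subst nn_integral_add) (auto simp: sub sets.Diff)
  finally show ?thesis .
qed

text \<open>As exponents are at least 1, dividing by l gains at least a factor 1 / l; thus a finite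
  modular i becomes at most 1 after division by i + 1, which bounds the norm.\<close>

lemma modular_divide_le:
  assumes "\<And>x. x \<in> \<Omega> \<Longrightarrow> 1 \<le> p x" "1 \<le> l"
    and [measurable]: "p \<in> borel_measurable (lebesgue_on \<Omega>)" "f \<in> borel_measurable (lebesgue_on \<Omega>)"
  shows "modular \<Omega> p (\<lambda>x. f x / l) \<le> ennreal (1 / l) * modular \<Omega> p f"
proof -
  have "modular \<Omega> p (\<lambda>x. f x / l) \<le> (\<integral>\<^sup>+x. ennreal (1 / l) * ennreal (\<bar>f x\<bar> powr p x) \<partial>lebesgue_on \<Omega>)"
    unfolding modular_def
  proof (rule nn_integral_mono)
    fix x assume "x \<in> space (lebesgue_on \<Omega>)"
    then have px: "1 \<le> p x" using assms(1) by (simp add: space_restrict_space)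
    have "(1 / l) powr p x \<le> (1 / l) powr 1" using px assms(2) by (intro powr_mono') auto
    moreover have "\<bar>f x / l\<bar> powr p x = (1 / l) powr p x * \<bar>f x\<bar> powr p x"
      using assms(2) by (simp add: abs_divide powr_divide powr_mult)
    ultimately have "\<bar>f x / l\<bar> powr p x \<le> 1 / l * \<bar>f x\<bar> powr p x"
      using assms(2) by (metis mult_right_mono powr_ge_zero powr_one zero_le_divide_1_iff order_trans zero_le_one)
    then show "ennreal (\<bar>f x / l\<bar> powr p x) \<le> ennreal (1 / l) * ennreal (\<bar>f x\<bar> powr p x)"
      using assms(2) by (simp add: ennreal_leI flip: ennreal_mult)
  qed
  also have "\<dots> = ennreal (1 / l) * modular \<Omega> p f"
    unfolding modular_def by (rule nn_integral_cmult) measurable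
  finally show ?thesis .
qed

lemma ennreal_inverse_mult_le_1:
  assumes "0 \<le> i" "i \<le> l" "0 < l"
  shows "ennreal (1 / l) * ennreal i \<le> 1"
  using assms by (simp flip: ennreal_mult)

text \<open>A membership criterion in terms of p alone. The bound 1 where p = 1 is enough here, as
  both the weighted power and the derivative of the modular satisfy it.\<close>

lemma gen_Lp_space_hoelder_conjI:
  assumes K: "K \<in> sets lebesgue"
    and p[measurable]: "p \<in> borel_measurable (lebesgue_on K)" and p1: "\<And>x. x \<in> K \<Longrightarrow> 1 \<le> p x"
    and h[measurable]: "h \<in> borel_measurable (lebesgue_on K)"
    and h1: "\<And>x. x \<in> K \<Longrightarrow> p x = 1 \<Longrightarrow> \<bar>h x\<bar> \<le> 1"
    and fin: "(\<integral>\<^sup>+x. (if p x = 1 then 0 else ennreal (\<bar>h x\<bar> powr (p x / (p x - 1)))) \<partial>lebesgue_on K) < \<infinity>"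
  shows "h \<in> gen_Lp_space K (hoelder_conj p)"
proof -
  define q where "q x = enn2real (hoelder_conj p x)" for x
  define A where "A = K \<inter> {x. hoelder_conj p x < \<infinity>}"
  define B where "B = K \<inter> {x. hoelder_conj p x = \<infinity>}"
  have q: "q x = p x / (p x - 1)" if "x \<in> A" for x
    using that p1[of x] by (auto simp: q_def hoelder_conj_def A_def)
  have "{x \<in> space (lebesgue_on K). p x \<noteq> 1} \<in> sets (lebesgue_on K)"
    "{x \<in> space (lebesgue_on K). p x = 1} \<in> sets (lebesgue_on K)"
    by measurable
  moreover have Aeq: "A = {x \<in> space (lebesgue_on K). p x \<noteq> 1}" "B = {x \<in> space (lebesgue_on K). p x = 1}"
    by (auto simp: A_def B_def hoelder_conj_def space_restrict_space)
  ultimately have AB: "A \<in> sets lebesgue" "B \<in> sets lebesgue" "A \<subseteq> K" "B \<subseteq> K"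
    using K by (auto simp: sets_restrict_space_iff space_restrict_space)
  have hA[measurable]: "h \<in> borel_measurable (lebesgue_on A)" "h \<in> borel_measurable (lebesgue_on B)"
    using measurable_restrict_mono[OF h] AB by auto
  have pA[measurable]: "p \<in> borel_measurable (lebesgue_on A)"
    using measurable_restrict_mono[OF p] AB by auto
  have "q \<in> borel_measurable (lebesgue_on A) \<longleftrightarrow> (\<lambda>x. p x / (p x - 1)) \<in> borel_measurable (lebesgue_on A)"
    by (intro measurable_cong) (use q in \<open>auto simp: space_restrict_space\<close>)
  then have [measurable]: "q \<in> borel_measurable (lebesgue_on A)" by simp
  have "modular A q h = (\<integral>\<^sup>+x. (if p x = 1 then 0 else ennreal (\<bar>h x\<bar> powr (p x / (p x - 1)))) * indicator K x \<partial>lebesgue)"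
    unfolding modular_def using AB
    by (subst nn_integral_restrict_space)
       (auto intro!: nn_integral_cong simp: q Aeq space_restrict_space indicator_def)
  then have "modular A q h < \<infinity>"
    using fin K by (simp add: nn_integral_restrict_space)
  then obtain i where i: "modular A q h = ennreal i" "0 \<le> i"
    by (cases "modular A q h") auto
  \<comment> \<open>After division by l the integral part is at most i / l and the essential
    supremum at most 1 / l, together exactly 1.\<close>
  define l where "l = i + 1"
  have l: "1 \<le> l" using i by (simp add: l_def)
  have "modular A q (\<lambda>x. h x / l) \<le> ennreal (1 / l) * ennreal i"
    unfolding i(1)[symmetric]
  proof (rule modular_divide_le[OF _ l])
    fix x assume x: "x \<in> A"
    then have "1 < p x" using p1[of x] by (auto simp: Aeq space_restrict_space less_le)
    then show "1 \<le> q x" using x by (simp add: q field_simps)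
  qed measurable
  moreover have "esssup (lebesgue_on B) (\<lambda>x. ennreal \<bar>h x / l\<bar>) \<le> ennreal (1 / l)"
  proof (rule esssup_I)
    show "AE x in lebesgue_on B. ennreal \<bar>h x / l\<bar> \<le> ennreal (1 / l)"
      using h1 l
      by (intro AE_I2) (auto simp: Aeq space_restrict_space abs_divide intro!: ennreal_leI divide_right_mono)
  qed measurable
  ultimately have "gen_modular K (hoelder_conj p) (\<lambda>x. h x / l) \<le> ennreal (1 / l) * ennreal i + ennreal (1 / l)"
    unfolding gen_modular_def A_def B_def q_def[abs_def] by (rule add_mono)
  also have "\<dots> = ennreal ((i + 1) / l)"
    using i l by (simp add: add_divide_distrib flip: ennreal_mult ennreal_plus)
  also have "\<dots> = 1" using l by (simp add: l_def)
  finally have "gen_Lp_norm K (hoelder_conj p) h \<le> ennreal l"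
    unfolding gen_Lp_norm_def luxemburg_norm_def using l by (intro Inf_lower) auto
  then show ?thesis
    unfolding gen_Lp_space_def using h by (auto intro: le_less_trans)
qed

section \<open>The span of the functions built from \<sigma>\<close>

definition ridge_sums :: "(real \<Rightarrow> real) \<Rightarrow> ('a::euclidean_space \<Rightarrow> real) set" where
  "ridge_sums \<sigma> = {v. \<exists>N \<alpha> w b. v = (\<lambda>x. \<Sum>j = 1..(N::nat). \<alpha> j * \<sigma> (w j \<bullet> x + b j))}"

lemma ridge_sums_zero: "(\<lambda>x. 0) \<in> ridge_sums \<sigma>"
  unfolding ridge_sums_def by (auto intro!: exI[of _ "0::nat"])

lemma ridge_sums_single: "(\<lambda>x. \<sigma> (w \<bullet> x + b)) \<in> ridge_sums \<sigma>"
proof -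
  have "(\<lambda>x. \<sigma> (w \<bullet> x + b)) = (\<lambda>x. \<Sum>j = 1..(1::nat). 1 * \<sigma> (w \<bullet> x + b))" by simp
  then show ?thesis unfolding ridge_sums_def by (intro CollectI exI)
qed

lemma ridge_sums_scale:
  assumes "v \<in> ridge_sums \<sigma>"
  shows "(\<lambda>x. c * v x) \<in> ridge_sums \<sigma>"
proof -
  obtain N \<alpha> w b where "v = (\<lambda>x. \<Sum>j = 1..(N::nat). \<alpha> j * \<sigma> (w j \<bullet> x + b j))"
    using assms by (auto simp: ridge_sums_def)
  then have "(\<lambda>x. c * v x) = (\<lambda>x. \<Sum>j = 1..N. (c * \<alpha> j) * \<sigma> (w j \<bullet> x + b j))"
    by (simp add: sum_distrib_left mult.assoc)
  then show ?thesis unfolding ridge_sums_def by (intro CollectI exI)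
qed

lemma ridge_sums_add:
  assumes "v \<in> ridge_sums \<sigma>" "v' \<in> ridge_sums \<sigma>"
  shows "(\<lambda>x. v x + v' x) \<in> ridge_sums \<sigma>"
proof -
  obtain N \<alpha> w b where v: "v = (\<lambda>x. \<Sum>j = 1..(N::nat). \<alpha> j * \<sigma> (w j \<bullet> x + b j))"
    using assms by (auto simp: ridge_sums_def)
  obtain N' \<alpha>' w' b' where v': "v' = (\<lambda>x. \<Sum>j = 1..(N'::nat). \<alpha>' j * \<sigma> (w' j \<bullet> x + b' j))"
    using assms by (auto simp: ridge_sums_def)
  \<comment> \<open>Concatenation: indices up to N belong to v, those from N + 1 on, shifted down by
    N, to v'.\<close>
  define F where "F x j = (if j \<le> N then \<alpha> j else \<alpha>' (j - N))
    * \<sigma> ((if j \<le> N then w j else w' (j - N)) \<bullet> x + (if j \<le> N then b j else b' (j - N)))" for x j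
  have "(\<Sum>j = 1..N + N'. F x j) = v x + v' x" for x
  proof -
    have "{1..N + N'} = {1..N} \<union> {N + 1..N + N'}" by auto
    then have "(\<Sum>j = 1..N + N'. F x j) = (\<Sum>j = 1..N. F x j) + (\<Sum>j = 1 + N..N' + N. F x j)"
      by (simp add: sum.union_disjoint add.commute)
    also have "(\<Sum>j = 1 + N..N' + N. F x j) = (\<Sum>j = 1..N'. F x (j + N))"
      by (rule sum.shift_bounds_cl_nat_ivl)
    also have "\<dots> = v' x"
      unfolding v' by (intro sum.cong) (auto simp: F_def)
    also have "(\<Sum>j = 1..N. F x j) = v x"
      unfolding v by (intro sum.cong) (auto simp: F_def)
    finally show ?thesis .
  qed
  then have "(\<lambda>x. v x + v' x) = (\<lambda>x. \<Sum>j = 1..N + N'. F x j)" by simp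
  then show ?thesis unfolding ridge_sums_def F_def by (intro CollectI exI)
qed

lemma truncated_sums_eq:
  "truncated_sums \<Omega> \<sigma> =
    {\<lambda>x. if x \<in> K then v x else 0 | K v. compact K \<and> K \<subseteq> \<Omega> \<and> v \<in> ridge_sums \<sigma>}"
proof (intro set_eqI iffI)
  fix g assume "g \<in> truncated_sums \<Omega> \<sigma>"
  then obtain K N \<alpha> w b where K: "compact K" "K \<subseteq> \<Omega>"
    and g: "g = (\<lambda>x. if x \<in> K then \<Sum>j = 1..(N::nat). \<alpha> j * \<sigma> (w j \<bullet> x + b j) else 0)"
    unfolding truncated_sums_def by blast
  define v where "v = (\<lambda>x. \<Sum>j = 1..N. \<alpha> j * \<sigma> (w j \<bullet> x + b j))"
  have "v \<in> ridge_sums \<sigma>" unfolding ridge_sums_def v_def by (intro CollectI exI) (rule refl)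
  moreover have "g = (\<lambda>x. if x \<in> K then v x else 0)" unfolding g v_def by (rule refl)
  ultimately show "g \<in> {\<lambda>x. if x \<in> K then v x else 0 | K v. compact K \<and> K \<subseteq> \<Omega> \<and> v \<in> ridge_sums \<sigma>}"
    using K by blast
next
  fix g assume "g \<in> {\<lambda>x. if x \<in> K then v x else 0 | K v. compact K \<and> K \<subseteq> \<Omega> \<and> v \<in> ridge_sums \<sigma>}"
  then obtain K v where K: "compact K" "K \<subseteq> \<Omega>" and v: "v \<in> ridge_sums \<sigma>"
    and g: "g = (\<lambda>x. if x \<in> K then v x else 0)"
    by blast
  obtain N \<alpha> w b where "v = (\<lambda>x. \<Sum>j = 1..(N::nat). \<alpha> j * \<sigma> (w j \<bullet> x + b j))"
    using v unfolding ridge_sums_def by blast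
  with g have "g = (\<lambda>x. if x \<in> K then \<Sum>j = 1..(N::nat). \<alpha> j * \<sigma> (w j \<bullet> x + b j) else 0)"
    by (simp only:)
  with K show "g \<in> truncated_sums \<Omega> \<sigma>"
    unfolding truncated_sums_def by blast
qed

lemma compact_sets_lebesgue: "compact (K :: 'a::euclidean_space set) \<Longrightarrow> K \<in> sets lebesgue"
  by (simp add: lmeasurable_compact fmeasurableD)

section \<open>Domains with an essentially bounded exponent\<close>

locale bounded_exponent_domain =
  fixes \<Omega> :: "'a::euclidean_space set" and p :: "'a \<Rightarrow> real" and P :: real
  assumes \<Omega>: "\<Omega> \<in> sets lebesgue"
    and p_meas [measurable]: "p \<in> borel_measurable (lebesgue_on \<Omega>)"
    and p_ge: "x \<in> \<Omega> \<Longrightarrow> 1 \<le> p x"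
    and p_le: "AE x in lebesgue_on \<Omega>. p x \<le> P"
    and P: "1 \<le> P"
begin

text \<open>The essential supremum bounds p only almost everywhere, whereas
  \<open>bounded_exponent_measure\<close> asks for a pointwise bound. Clipping alters p on a null
  set, hence no modular, and stays at least 1 since P is.\<close>

definition clip :: "'a \<Rightarrow> real" where
  "clip x = min (p x) P"

lemma AE_subset:
  assumes "A \<in> sets lebesgue" "A \<subseteq> \<Omega>" "AE x in lebesgue_on \<Omega>. Q x"
  shows "AE x in lebesgue_on A. Q x"
  using assms \<Omega> by (auto simp: AE_restrict_space_iff elim: eventually_mono)

lemma AE_clip:
  assumes "A \<in> sets lebesgue" "A \<subseteq> \<Omega>"
  shows "AE x in lebesgue_on A. clip x = p x"
  using AE_subset[OF assms p_le] by eventually_elim (simp add: clip_def)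

lemma modular_clip:
  assumes "A \<in> sets lebesgue" "A \<subseteq> \<Omega>"
  shows "modular A p f = modular A clip f"
  unfolding modular_def
  by (rule nn_integral_cong_AE, use AE_clip[OF assms] in eventually_elim) simp

lemma compact_exponent_measure:
  assumes K: "compact K" "K \<subseteq> \<Omega>"
  shows "bounded_exponent_measure (lebesgue_on K) clip P"
proof -
  have [measurable]: "p \<in> borel_measurable (lebesgue_on K)"
    using measurable_restrict_mono[OF p_meas] K by auto
  interpret finite_measure "lebesgue_on K"
    using fmeasurableD2[OF lmeasurable_compact[OF K(1)]] compact_sets_lebesgue[OF K(1)]
    by (intro finite_measureI) (simp add: emeasure_restrict_space space_restrict_space)
  show ?thesis
  proof
    show "clip \<in> borel_measurable (lebesgue_on K)"
      unfolding clip_def[abs_def] by measurable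
  qed (use p_ge K P in \<open>auto simp: clip_def space_restrict_space\<close>)
qed

lemma modular_eq_integral:
  assumes K: "compact K" "K \<subseteq> \<Omega>"
    and f: "f \<in> bounded_exponent_measure.finite_modular (lebesgue_on K) clip"
  shows "modular K p f = ennreal (\<integral>x. \<bar>f x\<bar> powr clip x \<partial>lebesgue_on K)"
proof -
  interpret K: bounded_exponent_measure "lebesgue_on K" clip P
    using K by (rule compact_exponent_measure)
  show ?thesis
    unfolding modular_clip[OF compact_sets_lebesgue[OF K(1)] K(2)] unfolding modular_def
    by (intro nn_integral_eq_integral K.integrable_abs_powr f) auto
qed

lemma gen_Lp_spaceI:
  assumes K: "compact K" "K \<subseteq> \<Omega>"
    and h: "h \<in> borel_measurable (lebesgue_on K)"
    and h1: "\<And>x. x \<in> K \<Longrightarrow> clip x = 1 \<Longrightarrow> \<bar>h x\<bar> \<le> 1"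
    and fin: "(\<integral>\<^sup>+x. (if clip x = 1 then 0 else ennreal (\<bar>h x\<bar> powr (clip x / (clip x - 1)))) \<partial>lebesgue_on K) < \<infinity>"
  shows "h \<in> gen_Lp_space K (hoelder_conj p)"
proof (rule gen_Lp_space_hoelder_conjI)
  show Kl: "K \<in> sets lebesgue" using K by (simp add: compact_sets_lebesgue)
  show "p \<in> borel_measurable (lebesgue_on K)"
    using measurable_restrict_mono[OF p_meas] K by auto
  show "\<bar>h x\<bar> \<le> 1" if "x \<in> K" "p x = 1" for x
    using h1[OF that(1)] that(2) P by (simp add: clip_def)
  have "(\<integral>\<^sup>+x. (if p x = 1 then 0 else ennreal (\<bar>h x\<bar> powr (p x / (p x - 1)))) \<partial>lebesgue_on K)
      = (\<integral>\<^sup>+x. (if clip x = 1 then 0 else ennreal (\<bar>h x\<bar> powr (clip x / (clip x - 1)))) \<partial>lebesgue_on K)"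
    using AE_clip[OF Kl K(2)] by (intro nn_integral_cong_AE) (auto elim!: eventually_mono)
  then show "(\<integral>\<^sup>+x. (if p x = 1 then 0 else ennreal (\<bar>h x\<bar> powr (p x / (p x - 1)))) \<partial>lebesgue_on K) < \<infinity>"
    using fin by simp
qed (use p_ge K h in auto)

text \<open>The integrability clause of \<open>discriminatory\<close> supplies exactly the products
  required by \<open>finite_modular_if_integrable_products\<close>.\<close>

lemma ridge_sums_subset_finite_modular:
  assumes K: "compact K" "K \<subseteq> \<Omega>" and disc: "discriminatory K p \<sigma>"
  shows "ridge_sums \<sigma> \<subseteq> bounded_exponent_measure.finite_modular (lebesgue_on K) clip"
proof -
  interpret K: bounded_exponent_measure "lebesgue_on K" clip P
    using K by (rule compact_exponent_measure)
  have int: "integrable (lebesgue_on K) (\<lambda>x. \<sigma> (w \<bullet> x + b) * h x)"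
    if "h \<in> gen_Lp_space K (hoelder_conj p)" for h w b
    using disc that unfolding discriminatory_def by blast
  have meas: "(\<lambda>x. \<sigma> (w \<bullet> x + b)) \<in> borel_measurable (lebesgue_on K)" for w b
  proof -
    \<comment> \<open>Testing the integrability clause with the constant 1 yields measurability of
      the ridge functions themselves.\<close>
    have "(\<lambda>x. 1) \<in> gen_Lp_space K (hoelder_conj p)"
    proof (rule gen_Lp_spaceI[OF K])
      have "(\<integral>\<^sup>+x. (if clip x = 1 then 0 else ennreal (\<bar>1\<bar> powr (clip x / (clip x - 1)))) \<partial>lebesgue_on K)
          \<le> (\<integral>\<^sup>+x. 1 \<partial>lebesgue_on K)"
        by (intro nn_integral_mono) auto
      also have "\<dots> = emeasure (lebesgue_on K) (space (lebesgue_on K))"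
        by (rule nn_integral_const[where c = 1, simplified mult_1])
      also have "\<dots> < \<infinity>"
        using K.finite_emeasure_space by (simp only: less_top infinity_ennreal_def)
      finally show "(\<integral>\<^sup>+x. (if clip x = 1 then 0 else ennreal (\<bar>1\<bar> powr (clip x / (clip x - 1)))) \<partial>lebesgue_on K) < \<infinity>" .
    qed auto
    from int[OF this, of w b] show ?thesis by (auto dest: borel_measurable_integrable)
  qed
  have single: "(\<lambda>x. \<sigma> (w \<bullet> x + b)) \<in> K.finite_modular" for w b
    by (rule K.finite_modular_if_integrable_products[OF meas])
       (auto intro!: int gen_Lp_spaceI[OF K] simp: space_restrict_space)
  have "(\<lambda>x. \<Sum>j = 1..N. \<alpha> j * \<sigma> (w j \<bullet> x + b j)) \<in> K.finite_modular" for N :: nat and \<alpha> w b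
    by (induction N) (simp_all add: K.finite_modular_0 K.finite_modular_add K.finite_modular_scale single)
  then show ?thesis by (auto simp: ridge_sums_def)
qed

text \<open>An annihilator of the form \<open>soft_power_deriv (clip x) (u x)\<close> lies in the
  conjugate space by its growth, so \<open>discriminatory\<close> makes it vanish almost everywhere;
  it vanishes only where u does.\<close>

lemma ridge_sums_approx_on_compact:
  assumes K: "compact K" "K \<subseteq> \<Omega>" and disc: "discriminatory K p \<sigma>"
    and f: "f \<in> bounded_exponent_measure.finite_modular (lebesgue_on K) clip" and e: "0 < e"
  shows "\<exists>v\<in>ridge_sums \<sigma>. modular K p (\<lambda>x. f x - v x) < ennreal e"
proof -
  interpret K: bounded_exponent_measure "lebesgue_on K" clip P
    using K by (rule compact_exponent_measure)
  note sub = ridge_sums_subset_finite_modular[OF K disc]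
  have ann: "AE x in lebesgue_on K. u x = 0"
    if u: "u \<in> K.finite_modular"
      and 0: "\<And>\<phi>. \<phi> \<in> ridge_sums \<sigma> \<Longrightarrow> (\<integral>x. soft_power_deriv (clip x) (u x) * \<phi> x \<partial>lebesgue_on K) = 0"
    for u
  proof -
    let ?h = "\<lambda>x. soft_power_deriv (clip x) (u x)"
    have [measurable]: "u \<in> borel_measurable (lebesgue_on K)" using u by measurable
    have "?h \<in> gen_Lp_space K (hoelder_conj p)"
    proof (rule gen_Lp_spaceI[OF K])
      show "\<bar>?h x\<bar> \<le> 1" if "clip x = 1" for x
        using abs_soft_power_deriv_le[of "clip x" "u x"] that by simp
      have "(\<integral>\<^sup>+x. (if clip x = 1 then 0 else ennreal (\<bar>?h x\<bar> powr (clip x / (clip x - 1)))) \<partial>lebesgue_on K)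
          \<le> (\<integral>\<^sup>+x. ennreal (soft_abs (u x) powr clip x) \<partial>lebesgue_on K)"
      proof (intro nn_integral_mono)
        fix x assume x: "x \<in> space (lebesgue_on K)"
        show "(if clip x = 1 then 0 else ennreal (\<bar>?h x\<bar> powr (clip x / (clip x - 1))))
            \<le> ennreal (soft_abs (u x) powr clip x)"
        proof (cases "clip x = 1")
          case False
          then have c: "1 < clip x" using K.p_ge_1[OF x] by simp
          have "\<bar>?h x\<bar> powr (clip x / (clip x - 1)) \<le> (soft_abs (u x) powr (clip x - 1)) powr (clip x / (clip x - 1))"
            using c by (intro powr_mono2 abs_soft_power_deriv_le) auto
          also have "\<dots> = soft_abs (u x) powr clip x"
            using c by (simp add: powr_powr)
          finally show ?thesis using False by (simp add: ennreal_leI)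
        qed simp
      qed
      also have "\<dots> < \<infinity>"
        using K.finite_modular_integrable[OF u] by (simp add: nn_integral_eq_integral)
      finally show "(\<integral>\<^sup>+x. (if clip x = 1 then 0 else ennreal (\<bar>?h x\<bar> powr (clip x / (clip x - 1)))) \<partial>lebesgue_on K) < \<infinity>" .
    qed simp
    note disc[unfolded discriminatory_def, rule_format, OF this, THEN conjunct2]
    moreover have "\<forall>w b. (\<integral>x. \<sigma> (w \<bullet> x + b) * ?h x \<partial>lebesgue_on K) = 0"
      using 0[OF ridge_sums_single] by (simp add: mult.commute)
    ultimately have "AE x in lebesgue_on K. ?h x = 0" by simp
    then show ?thesis by simp
  qed
  obtain v where v: "v \<in> ridge_sums \<sigma>" and less: "(\<integral>x. \<bar>f x - v x\<bar> powr clip x \<partial>lebesgue_on K) < e"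
    using K.modular_approx_if_annihilators_trivial[OF sub ridge_sums_zero ridge_sums_add
        ridge_sums_scale ann f e] by blast
  have "(\<lambda>x. f x - v x) \<in> K.finite_modular"
    using v sub f by (intro K.finite_modular_diff) auto
  from modular_eq_integral[OF K this] have "modular K p (\<lambda>x. f x - v x) < ennreal e"
    using less e by (simp add: ennreal_lessI)
  then show ?thesis using v by blast
qed

text \<open>A finite norm controls the modular at one scale \<open>l0\<close> only; boundedness of p
  extends finiteness to every scale.\<close>

lemma modular_finite_scale:
  assumes f: "f \<in> Lp_space \<Omega> p" and l: "0 < l"
  shows "modular \<Omega> p (\<lambda>x. f x / l) < \<infinity>"
proof -
  have [measurable]: "f \<in> borel_measurable (lebesgue_on \<Omega>)"
    using f by (simp add: Lp_space_def)
  have "Lp_norm \<Omega> p f < \<infinity>" using f by (simp add: Lp_space_def)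
  then obtain l0 where l0: "0 < l0" "modular \<Omega> p (\<lambda>x. f x / l0) \<le> 1"
    unfolding Lp_norm_def luxemburg_norm_def Inf_less_iff by auto
  \<comment> \<open>The summand 1 makes the base at least 1, so that its power is monotone in the
    exponent and at most \<open>c powr P\<close>.\<close>
  define c where "c = 1 + l0 / l"
  have "modular \<Omega> p (\<lambda>x. f x / l) \<le> (\<integral>\<^sup>+x. ennreal (c powr P) * ennreal (\<bar>f x / l0\<bar> powr p x) \<partial>lebesgue_on \<Omega>)"
    unfolding modular_def
  proof (rule nn_integral_mono_AE, use p_le AE_space in eventually_elim)
    fix x assume px: "p x \<le> P" and "x \<in> space (lebesgue_on \<Omega>)"
    then have p1: "1 \<le> p x" using p_ge by (simp add: space_restrict_space)
    have "\<bar>f x / l\<bar> powr p x = (l0 / l * \<bar>f x / l0\<bar>) powr p x"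
      using l l0 by (simp add: abs_divide)
    also have "\<dots> = (l0 / l) powr p x * \<bar>f x / l0\<bar> powr p x"
      using l l0 by (intro powr_mult)
    also have "\<dots> \<le> c powr P * \<bar>f x / l0\<bar> powr p x"
    proof (rule mult_right_mono)
      have "(l0 / l) powr p x \<le> c powr p x"
        using l l0 p1 by (intro powr_mono2) (auto simp: c_def)
      also have "\<dots> \<le> c powr P" using l l0 px by (intro powr_mono) (auto simp: c_def)
      finally show "(l0 / l) powr p x \<le> c powr P" .
    qed simp
    finally show "ennreal (\<bar>f x / l\<bar> powr p x) \<le> ennreal (c powr P) * ennreal (\<bar>f x / l0\<bar> powr p x)"
      by (simp add: ennreal_leI flip: ennreal_mult)
  qed
  also have "\<dots> = ennreal (c powr P) * modular \<Omega> p (\<lambda>x. f x / l0)"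
    unfolding modular_def by (rule nn_integral_cmult) measurable
  also have "\<dots> \<le> ennreal (c powr P) * 1"
    using l0(2) by (intro mult_left_mono) auto
  also have "\<dots> < \<infinity>" by simp
  finally show ?thesis .
qed

text \<open>Up to a null set \<Omega> is a countable union of compact sets; the tails over their
  finite unions vanish by dominated convergence, with the integrand of the finite modular as
  majorant.\<close>

lemma compact_exhaustion:
  assumes [measurable]: "f \<in> borel_measurable (lebesgue_on \<Omega>)"
    and fin: "modular \<Omega> p f < \<infinity>" and e: "0 < e"
  obtains K where "compact K" "K \<subseteq> \<Omega>" "modular (\<Omega> - K) p f < ennreal e"
proof -
  obtain C T where CT: "fsigma C" "T \<in> null_sets lebesgue" "C \<union> T = \<Omega>"
    using lebesgue_set_almost_fsigma[OF \<Omega>] by metis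
  obtain F :: "nat \<Rightarrow> 'a set" where "range F \<subseteq> Collect compact" "C = (\<Union>n. F n)"
    using CT(1) unfolding fsigma_Union_compact by blast
  then have F: "\<And>n. compact (F n)" "C = (\<Union>n. F n)" by auto
  define K where "K n = (\<Union>i\<le>n. F i)" for n
  have K: "compact (K n)" "K n \<subseteq> \<Omega>" for n
    using F CT(3) by (auto simp: K_def)
  have Kl: "K n \<in> sets lebesgue" for n using K(1) by (rule compact_sets_lebesgue)
  let ?F = "\<lambda>x. ennreal (\<bar>f x\<bar> powr p x)"
  have [measurable]: "K n \<in> sets (lebesgue_on \<Omega>)" for n
    using Kl K \<Omega> by (auto simp: sets_restrict_space_iff)
  have "(\<lambda>n. \<integral>\<^sup>+x. ?F x * indicator (- K n) x \<partial>lebesgue_on \<Omega>) \<longlonglongrightarrow> (\<integral>\<^sup>+x. 0 \<partial>lebesgue_on \<Omega>)"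
  proof (rule nn_integral_dominated_convergence[where w = ?F])
    have "(\<lambda>x. ?F x * indicator (space (lebesgue_on \<Omega>) - K n) x) \<in> borel_measurable (lebesgue_on \<Omega>)" for n
      by measurable
    moreover have "(\<lambda>x. ?F x * indicator (space (lebesgue_on \<Omega>) - K n) x) \<in> borel_measurable (lebesgue_on \<Omega>)
      \<longleftrightarrow> (\<lambda>x. ?F x * indicator (- K n) x) \<in> borel_measurable (lebesgue_on \<Omega>)" for n
      by (intro measurable_cong) (auto simp: indicator_def)
    ultimately show "(\<lambda>x. ?F x * indicator (- K n) x) \<in> borel_measurable (lebesgue_on \<Omega>)" for n
      by simp
    show "(\<integral>\<^sup>+x. ?F x \<partial>lebesgue_on \<Omega>) < \<infinity>"
      using fin by (simp add: modular_def)
    have "AE x in lebesgue_on \<Omega>. x \<notin> T"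
      using CT \<Omega> by (auto simp: AE_restrict_space_iff intro: AE_not_in[THEN eventually_mono])
    then show "AE x in lebesgue_on \<Omega>. (\<lambda>n. ?F x * indicator (- K n) x) \<longlonglongrightarrow> 0"
      using AE_space
    proof eventually_elim
      fix x assume "x \<notin> T" "x \<in> space (lebesgue_on \<Omega>)"
      then have "x \<in> C" using CT(3) by (auto simp: space_restrict_space)
      then obtain n where "x \<in> F n" using F by auto
      then have "\<forall>\<^sub>F k in sequentially. ?F x * indicator (- K k) x = 0"
        unfolding eventually_sequentially by (intro exI[of _ n]) (auto simp: K_def indicator_def)
      then show "(\<lambda>n. ?F x * indicator (- K n) x) \<longlonglongrightarrow> 0"
        by (rule tendsto_eventually)
    qed
  qed (auto simp: indicator_def)
  then have "\<forall>\<^sub>F n in sequentially. (\<integral>\<^sup>+x. ?F x * indicator (- K n) x \<partial>lebesgue_on \<Omega>) < ennreal e"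
    using e by (intro order_tendstoD) auto
  then obtain n where n: "(\<integral>\<^sup>+x. ?F x * indicator (- K n) x \<partial>lebesgue_on \<Omega>) < ennreal e"
    by (auto simp: eventually_sequentially)
  have "modular (\<Omega> - K n) p f = (\<integral>\<^sup>+x. ?F x * indicator (- K n) x \<partial>lebesgue_on \<Omega>)"
    unfolding modular_def using \<Omega> Kl[of n] K
    by (simp add: nn_integral_restrict_space sets.Diff) (auto intro!: nn_integral_cong simp: indicator_def)
  with n that[OF K] show ?thesis by metis
qed

lemma truncated_measurable:
  assumes K: "compact K" "K \<subseteq> \<Omega>" and v: "v \<in> borel_measurable (lebesgue_on K)"
  shows "(\<lambda>x. if x \<in> K then v x else 0 :: real) \<in> borel_measurable (lebesgue_on \<Omega>)"
proof -
  have Kl: "K \<in> sets lebesgue" using K by (simp add: compact_sets_lebesgue)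
  have "(\<lambda>x. indicator K x *\<^sub>R v x) \<in> borel_measurable lebesgue"
    using v Kl by (simp add: borel_measurable_restrict_space_iff)
  moreover have "(\<lambda>x. indicator \<Omega> x *\<^sub>R (if x \<in> K then v x else 0)) = (\<lambda>x. indicator K x *\<^sub>R v x)"
    using K by (auto simp: fun_eq_iff indicator_def)
  ultimately show ?thesis
    using \<Omega> by (subst borel_measurable_restrict_space_iff) auto
qed

lemma truncated_sums_subset_Lp_space:
  assumes disc: "\<And>K. compact K \<Longrightarrow> K \<subseteq> \<Omega> \<Longrightarrow> discriminatory K p \<sigma>"
  shows "truncated_sums \<Omega> \<sigma> \<subseteq> Lp_space \<Omega> p"
proof
  fix g assume "g \<in> truncated_sums \<Omega> \<sigma>"
  then obtain K v where g: "g = (\<lambda>x. if x \<in> K then v x else 0)" and K: "compact K" "K \<subseteq> \<Omega>"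
    and v: "v \<in> ridge_sums \<sigma>" by (auto simp: truncated_sums_eq)
  interpret K: bounded_exponent_measure "lebesgue_on K" clip P
    using K by (rule compact_exponent_measure)
  have Kl: "K \<in> sets lebesgue" using K by (simp add: compact_sets_lebesgue)
  have vK: "v \<in> K.finite_modular"
    using v ridge_sums_subset_finite_modular[OF K disc[OF K]] by auto
  have [measurable]: "g \<in> borel_measurable (lebesgue_on \<Omega>)"
    unfolding g using K vK by (intro truncated_measurable K.finite_modular_measurable)
  have "modular (\<Omega> - K) p g = modular (\<Omega> - K) p (\<lambda>x. 0)"
    by (rule modular_cong) (simp add: g)
  moreover have "modular K p g = modular K p v"
    by (rule modular_cong) (simp add: g)
  ultimately have "modular \<Omega> p g = modular K p v"
    using modular_split[OF \<Omega> Kl K(2) p_meas \<open>g \<in> borel_measurable (lebesgue_on \<Omega>)\<close>]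
    by (simp add: modular_def)
  then obtain i where i: "modular \<Omega> p g = ennreal i" "0 \<le> i"
    unfolding modular_eq_integral[OF K vK] by (intro that[of "integral\<^sup>L (lebesgue_on K) (\<lambda>x. \<bar>v x\<bar> powr clip x)"]) auto
  have "modular \<Omega> p (\<lambda>x. g x / (i + 1)) \<le> ennreal (1 / (i + 1)) * ennreal i"
    unfolding i(1)[symmetric] using i by (intro modular_divide_le p_ge) auto
  also have "\<dots> \<le> 1" using i by (intro ennreal_inverse_mult_le_1) auto
  finally have "Lp_norm \<Omega> p g \<le> ennreal (i + 1)"
    using i by (intro Lp_norm_le) auto
  then show "g \<in> Lp_space \<Omega> p"
    by (auto simp: Lp_space_def intro: le_less_trans)
qed

text \<open>A norm at most l follows from a modular at most 1 of the quotient by l. Half of this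
  budget goes to f outside a compact K, half to the approximation on K; l = e / 2 gives the strict
  inequality.\<close>

lemma truncated_sums_approx:
  assumes disc: "\<And>K. compact K \<Longrightarrow> K \<subseteq> \<Omega> \<Longrightarrow> discriminatory K p \<sigma>"
    and f: "f \<in> Lp_space \<Omega> p" and e: "0 < e"
  shows "\<exists>g\<in>truncated_sums \<Omega> \<sigma>. Lp_norm \<Omega> p (\<lambda>x. f x - g x) < ennreal e"
proof -
  have [measurable]: "f \<in> borel_measurable (lebesgue_on \<Omega>)"
    using f by (simp add: Lp_space_def)
  define l where "l = e / 2"
  have l: "0 < l" using e by (simp add: l_def)
  let ?f = "\<lambda>x. f x / l"
  obtain K where K: "compact K" "K \<subseteq> \<Omega>" and tail: "modular (\<Omega> - K) p ?f < ennreal (1 / 2)"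
    using compact_exhaustion[OF _ modular_finite_scale[OF f l], of "1 / 2"] by auto
  interpret K: bounded_exponent_measure "lebesgue_on K" clip P
    using K by (rule compact_exponent_measure)
  have Kl: "K \<in> sets lebesgue" using K by (simp add: compact_sets_lebesgue)
  have fK [measurable]: "?f \<in> borel_measurable (lebesgue_on K)"
    using measurable_restrict_mono[of ?f lebesgue \<Omega> borel K] K by auto
  have "modular K p ?f \<le> modular \<Omega> p ?f"
    by (subst modular_split[OF \<Omega> Kl K(2)]) auto
  also have "\<dots> < \<infinity>" by (rule modular_finite_scale[OF f l])
  finally have "modular K clip ?f < \<infinity>"
    using modular_clip[OF Kl K(2)] by simp
  then have "integrable (lebesgue_on K) (\<lambda>x. \<bar>?f x\<bar> powr clip x)"
    by (intro integrableI_bounded) (measurable, simp add: modular_def)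
  then have "?f \<in> K.finite_modular"
    by (intro K.finite_modularI fK)
  then obtain v where v: "v \<in> ridge_sums \<sigma>" and head: "modular K p (\<lambda>x. ?f x - v x) < ennreal (1 / 2)"
    using ridge_sums_approx_on_compact[OF K disc[OF K], of ?f "1 / 2"] by auto
  \<comment> \<open>The sum v approximates f / l, hence the factor l.\<close>
  define g where "g = (\<lambda>x. if x \<in> K then l * v x else 0)"
  have gT: "g \<in> truncated_sums \<Omega> \<sigma>"
    using K ridge_sums_scale[OF v, of l] unfolding truncated_sums_eq g_def
    by (intro CollectI exI[of _ K] exI[of _ "\<lambda>x. l * v x"]) simp
  then have [measurable]: "g \<in> borel_measurable (lebesgue_on \<Omega>)"
    using truncated_sums_subset_Lp_space[OF disc] by (auto simp: Lp_space_def)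
  have "modular \<Omega> p (\<lambda>x. (f x - g x) / l)
      = modular K p (\<lambda>x. (f x - g x) / l) + modular (\<Omega> - K) p (\<lambda>x. (f x - g x) / l)"
    by (rule modular_split[OF \<Omega> Kl K(2)]) auto
  also have "modular K p (\<lambda>x. (f x - g x) / l) = modular K p (\<lambda>x. ?f x - v x)"
    using l by (intro modular_cong) (simp add: g_def diff_divide_distrib)
  also have "modular (\<Omega> - K) p (\<lambda>x. (f x - g x) / l) = modular (\<Omega> - K) p ?f"
    by (intro modular_cong) (simp add: g_def)
  also have "modular K p (\<lambda>x. ?f x - v x) + modular (\<Omega> - K) p ?f \<le> ennreal (1 / 2) + ennreal (1 / 2)"
    using head tail by (intro add_mono) auto
  also have "\<dots> = 1" by (subst ennreal_plus[symmetric]) auto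
  finally have "Lp_norm \<Omega> p (\<lambda>x. f x - g x) \<le> ennreal l"
    using l by (intro Lp_norm_le)
  also have "\<dots> < ennreal e" using e by (simp add: l_def ennreal_lessI)
  finally show ?thesis using gT by blast
qed

end

theorem theorem5p3:
  fixes \<Omega> :: "(real ^ 'd) set" and p :: "real ^ 'd \<Rightarrow> real" and \<sigma> :: "real \<Rightarrow> real"
  assumes "\<Omega> \<in> sets lebesgue"
    and "bounded_exponent \<Omega> p"
    and "\<And>K. compact K \<Longrightarrow> K \<subseteq> \<Omega> \<Longrightarrow> discriminatory K p \<sigma>"
  shows "dense_in_Lp \<Omega> p (truncated_sums \<Omega> \<sigma>)"
proof -
  obtain P where P: "1 \<le> P" "esssup (lebesgue_on \<Omega>) (\<lambda>x. ereal (p x)) \<le> ereal P"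
  proof (cases "esssup (lebesgue_on \<Omega>) (\<lambda>x. ereal (p x))")
    case (real r)
    then show ?thesis by (intro that[of "max 1 r"]) auto
  next
    case PInf
    then show ?thesis using assms(2) by (simp add: bounded_exponent_def)
  next
    \<comment> \<open>This value occurs when \<Omega> is a null set; any bound will do.\<close>
    case MInf
    then show ?thesis by (intro that[of 1]) auto
  qed
  have "AE x in lebesgue_on \<Omega>. p x \<le> P"
    using esssup_AE[of "\<lambda>x. ereal (p x)" "lebesgue_on \<Omega>"]
  proof eventually_elim
    case (elim x)
    then show ?case using P(2) order_trans by fastforce
  qed
  then interpret bounded_exponent_domain \<Omega> p P
    using assms(1,2) P(1)
    by unfold_locales (auto simp: bounded_exponent_def exponent_function_def)
  show ?thesis
    unfolding dense_in_Lp_def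
    using truncated_sums_subset_Lp_space truncated_sums_approx assms(3) by blast
qed

end
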